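(* Let $\mathfrak g$ be of affine type $A_{2n}^{(2)}$, $D_{n+1}^{(2)}$, $A_{2n-1}^{(2)}$, $D_n^{(1)}$, $B_n^{(1)}$ or $C_n^{(1)}$ and let $l\ge 1$ be an integer. Let $\mathcal C^{(l)}$ be the set of level-$l$ reduced Young columns, equipped with the maps $\tilde{\mathfrak e}_i,\tilde{\mathfrak f}_i,\epsilon_i,\phi_i$ $(i\in I)$ and $\mathrm{wt}$, and let $\mathcal B^{(l)}$ be the level-$l$ perfect crystal of the given type. Then the map $$\Phi:\mathcal C^{(l)}\longrightarrow \mathcal B^{(l)},\qquad C_b\longmapsto b,$$ is an isomorphism of $U_q'(\mathfrak g)$-crystals.
   Context: **Types.** $I=\{0,1,\dots,n\}$. The types are $A_{2n}^{(2)}$ ($n\ge1$), $D_{n+1}^{(2)}$ ($n\ge2$), $A_{2n-1}^{(2)}$ ($n\ge3$), $D_n^{(1)}$ ($n\ge4$), $B_n^{(1)}$ ($n\ge3$), $C_n^{(1)}$ ($n\ge2$). $\Lambda_i$ denotes the (classical images of the) fundamental weights; $U_q'(\mathfrak g)$-crystals have weights in $P_{\rm cl}=\bigoplus_i\mathbf Z\Lambda_i$. A crystal isomorphism is a bijection commuting with all Kashiwara operators (with $0\mapsto0$) and preserving $\mathrm{wt},\varepsilon_i,\varphi_i$. Put $(a)_+=\max(0,a)$. **Blocks, slices, stacking patterns.** Blocks are colored by $I$, have height $1$, width $1/l$ (width $1/2l$ for $C_n^{(1)}$), and depth $1$ or $1/2$. A slice is a vertical stack of blocks of unit total depth and of width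 one block. A layer of a slice is either one unit-depth block or two half-depth blocks (one in front, one at the back), the latter written $(a,b)$ with $a$ in front and $b$ at the back. From bottom to top a slice is filled periodically according to the following sequence of layers; one complete period is called a $\delta$-slice: - $A_{2n}^{(2)}$ and $C_n^{(1)}$: $(0,0),1,2,\dots,n-1,n,n-1,\dots,2,1$; - $D_{n+1}^{(2)}$: $(0,0),1,\dots,n-1,(n,n),n-1,\dots,1$; - $A_{2n-1}^{(2)}$: $(0,1),2,\dots,n-1,n,n-1,\dots,2$; - $D_n^{(1)}$: $(0,1),2,\dots,n-2,(n-1,n),n-2,\dots,2$; - $B_n^{(1)}$: $(0,1),2,\dots,n-1,(n,n),n-1,\dots,2$. A unit-depth block may be placed only on a complete layer. A level-$l$ Young column consists of $l$ slices ($2l$ slices for $C_n^{(1)}$) placed side by side in a column of unit width, each filled with finitely many blocks by this pattern, such that the number of blocks in a slice weakly decreases from right to left. A $\delta$-slice in a column is removable if there is at least one block on top of it; the column is reduced if it has no removable $\delta$-slice. **Reduced Young columns.** They are parametrized as follows. Slice classes: - For $A_{2n}^{(2)},D_{n+1}^{(2)},C_n^{(1)}$: $s_*$ = one half-depth $0$-block only (at the back); $s_i$ ($1\le i\le n$) = $(0,0),1,\dots,i-1$; $\bar s_n$ = all layers of the $\delta$-slice up to and including the $n$-layer (complete); $\bar s_i$ ($1\le i\le n-1$) = all layers up to and including the second (descending) $i$-layer, so that $\bar s_1$ is a full $\delta$-slice. For $D_{n+1}^{(2)}$ also $s_0$ = $(0,0),1,\dots,n-1$ and one half-depth $n$-block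 (at the back). - For $A_{2n-1}^{(2)},D_n^{(1)},B_n^{(1)}$: $s_1$ = one half-depth $0$-block only; $\bar s_1$ = one half-depth $1$-block only; $s_2$ = $(0,1)$; $s_i$ = $(0,1),2,\dots,i-1$ for $3\le i\le n$ (only for $3\le i\le n-1$ in type $D_n^{(1)}$); $\bar s_i$ ($2\le i\le n$; only $2\le i\le n-2$ in type $D_n^{(1)}$) = all layers up to and including the (last) $i$-layer, so that $\bar s_2$ is a full $\delta$-slice. For $B_n^{(1)}$ also $s_0$ = $(0,1),2,\dots,n-1$ and one half-depth $n$-block (at the back). For $D_n^{(1)}$: $s_n$ = $(0,1),2,\dots,n-2$ and one half-depth $(n-1)$-block; $\bar s_n$ = $(0,1),2,\dots,n-2$ and one half-depth $n$-block; $\bar s_{n-1}$ = $(0,1),2,\dots,n-2,(n-1,n)$. For $b=(x_1,\dots,x_n,\bar x_n,\dots,\bar x_1)$ (or $b=(x_1,\dots,x_n,x_0,\bar x_n,\dots,\bar x_1)$ for $D_{n+1}^{(2)},B_n^{(1)}$) in the index set $\mathcal B^{(l)}$ below, $C_b$ is the column with $x_i$ slices of class $s_i$, $\bar x_i$ slices of class $\bar s_i$, $x_0$ slices of class $s_0$ where applicable, and, for $A_{2n}^{(2)},D_{n+1}^{(2)},C_n^{(1)}$, $l'$ slices of class $s_*$, where $l'=l-\sum_i(x_i+\bar x_i)$, $l'=l-x_0-\sum_i(x_i+\bar x_i)$, $l'=2l-\sum_i(x_i+\bar x_i)$ respectively; the classes are ordered from left to right as $s_*,s_1,s_2,\dots,s_n,s_0,\bar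 s_n,\dots,\bar s_1$ for these three types and $s_1,\bar s_1,s_2,s_3,\dots,s_n,s_0,\bar s_n,\dots,\bar s_2$ for the other three. $\mathcal C^{(l)}$ is the set of all $C_b$. **Operators on $\mathcal C^{(l)}$.** $\tilde{\mathfrak f}_i$ adds one $i$-block to the rightmost slice of the class specified below (giving $0$ if there is no such slice), and then removes all removable $\delta$-slices (the blocks above falling down) and rearranges slices to obtain again a column of the form $C_{b'}$. 1. $1\le i\le n-1$ for $A_{2n}^{(2)},D_{n+1}^{(2)},C_n^{(1)}$; $2\le i\le n-1$ for $A_{2n-1}^{(2)},B_n^{(1)}$; $2\le i\le n-2$ for $D_n^{(1)}$: to a slice of class $s_i$ if $x_{i+1}\ge\bar x_{i+1}$, of class $\bar s_{i+1}$ if $x_{i+1}<\bar x_{i+1}$. 2. $A_{2n}^{(2)},D_{n+1}^{(2)}$, $i=0$: class $s_*$ if $x_1\ge\bar x_1$, class $\bar s_1$ if $x_1<\bar x_1$. 3. $A_{2n-1}^{(2)},D_n^{(1)},B_n^{(1)}$, $i=1$: class $s_1$ if $x_2\ge\bar x_2$, class $\bar s_2$ if $x_2<\bar x_2$; $i=0$: class $\bar s_1$ if $x_2\ge \bar x_2$, class $\bar s_2$ if $x_2<\bar x_2$. 4. $D_{n+1}^{(2)},B_n^{(1)}$, $i=n$: class $s_n$ if $x_0=0$, class $s_0$ if $x_0=1$. $A_{2n}^{(2)},C_n^{(1)},A_{2n-1}^{(2)}$, $i=n$: class $s_n$. 5. $D_n^{(1)}$, $i=n-1$: class $s_{n-1}$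 if $\bar x_n=0$, class $\bar s_n$ if $x_n=0,\bar x_n\ge1$; $i=n$: class $s_n$ if $x_n\ge1,\bar x_n=0$, class $s_{n-1}$ if $x_n=0$. 6. $C_n^{(1)}$, $i=0$: two half-depth $0$-blocks are added, and count together as one $0$-block: one on each of the two rightmost slices of class $s_*$ if $x_1\ge\bar x_1$; both on the rightmost slice of class $\bar s_1$ if $x_1=\bar x_1-1$; one on each of the two rightmost slices of class $\bar s_1$ if $x_1\le\bar x_1-2$. $\tilde{\mathfrak e}_iC=C'$ if and only if $\tilde{\mathfrak f}_iC'=C$ (and $\tilde{\mathfrak e}_iC=0$ if no such $C'$ exists). **Counting.** $\epsilon_i(C)$ and $\phi_i(C)$ are the numbers of $i$-blocks which can be removed from, respectively added to, $C$; here the blocks on slices of classes $s_{j}$ and $\bar s_{j}$ cancel each other in pairs, so that in particular (for $j\ge 1$ in types $A_{2n}^{(2)},D_{n+1}^{(2)},C_n^{(1)}$) no $(j-1)$-block can be removed from or added to these slices when $x_{j}=\bar x_{j}$, and similarly for $0$- and $1$-blocks on slices $s_2,\bar s_2$ in types $A_{2n-1}^{(2)},D_n^{(1)},B_n^{(1)}$. Explicitly: - for $i$ as in item 1: $\epsilon_i=\bar x_i+(x_{i+1}-\bar x_{i+1})_+$, $\phi_i=x_i+(\bar x_{i+1}-x_{i+1})_+$; - $A_{2n}^{(2)},D_{n+1}^{(2)}$: $\epsilon_0=l'+2(x_1-\bar x_1)_+$, $\phi_0=l'+2(\bar x_1-x_1)_+$; $C_n^{(1)}$: $\epsilon_0=l'/2+(x_1-\bar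 x_1)_+$, $\phi_0=l'/2+(\bar x_1-x_1)_+$; - $A_{2n-1}^{(2)},D_n^{(1)},B_n^{(1)}$: $\epsilon_0=x_1+(x_2-\bar x_2)_+$, $\phi_0=\bar x_1+(\bar x_2-x_2)_+$, $\epsilon_1=\bar x_1+(x_2-\bar x_2)_+$, $\phi_1=x_1+(\bar x_2-x_2)_+$; - $A_{2n}^{(2)},C_n^{(1)},A_{2n-1}^{(2)}$: $\epsilon_n=\bar x_n$, $\phi_n=x_n$; $D_{n+1}^{(2)},B_n^{(1)}$: $\epsilon_n=2\bar x_n+x_0$, $\phi_n=2x_n+x_0$; - $D_n^{(1)}$: $\epsilon_{n-1}=\bar x_{n-1}+x_n$, $\phi_{n-1}=x_{n-1}+\bar x_n$, $\epsilon_n=\bar x_{n-1}+\bar x_n$, $\phi_n=x_{n-1}+x_n$. $\mathrm{wt}(C)=\sum_{i\in I}(\phi_i(C)-\epsilon_i(C))\Lambda_i$. **The perfect crystal $\mathcal B^{(l)}$.** As a set it consists of vectors with all entries in $\mathbf Z_{\ge0}$: for $A_{2n}^{(2)}$, $(x_1,\dots,x_n|\bar x_n,\dots,\bar x_1)$ with $\sum(x_i+\bar x_i)\le l$; for $D_{n+1}^{(2)}$, $(x_1,\dots,x_n|x_0|\bar x_n,\dots,\bar x_1)$ with $x_0\in\{0,1\}$ and $x_0+\sum(x_i+\bar x_i)\le l$; for $C_n^{(1)}$, $(x_1,\dots,x_n|\bar x_n,\dots,\bar x_1)$ with $\sum(x_i+\bar x_i)$ even and $\le2l$; for $A_{2n-1}^{(2)}$,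 $\sum(x_i+\bar x_i)=l$; for $D_n^{(1)}$, $\sum(x_i+\bar x_i)=l$ and ($x_n=0$ or $\bar x_n=0$); for $B_n^{(1)}$, with $x_0\in\{0,1\}$, $x_0+\sum(x_i+\bar x_i)=l$. Its Kashiwara operators $\tilde f_i$ are (coordinates not mentioned are unchanged; the result is $0$ if it is not in $\mathcal B^{(l)}$): - $i$ as in item 1: $(x_i,x_{i+1})\mapsto(x_i-1,x_{i+1}+1)$ if $x_{i+1}\ge\bar x_{i+1}$; $(\bar x_{i+1},\bar x_i)\mapsto(\bar x_{i+1}-1,\bar x_i+1)$ if $x_{i+1}<\bar x_{i+1}$; - $A_{2n}^{(2)},D_{n+1}^{(2)}$, $i=0$: $x_1\mapsto x_1+1$ if $x_1\ge\bar x_1$; $\bar x_1\mapsto\bar x_1-1$ if $x_1<\bar x_1$; - $C_n^{(1)}$, $i=0$: $x_1\mapsto x_1+2$ if $x_1\ge\bar x_1$; $(x_1,\bar x_1)\mapsto(x_1+1,\bar x_1-1)$ if $x_1=\bar x_1-1$; $\bar x_1\mapsto\bar x_1-2$ if $x_1\le\bar x_1-2$; - $A_{2n-1}^{(2)},D_n^{(1)},B_n^{(1)}$, $i=0$: $(x_2,\bar x_1)\mapsto(x_2+1,\bar x_1-1)$ if $x_2\ge\bar x_2$; $(x_1,\bar x_2)\mapsto(x_1+1,\bar x_2-1)$ if $x_2<\bar x_2$; $i=1$: $(x_1,x_2)\mapsto(x_1-1,x_2+1)$ if $x_2\ge\bar x_2$; $(\bar x_2,\bar x_1)\mapsto(\bar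 x_2-1,\bar x_1+1)$ if $x_2<\bar x_2$; - $D_{n+1}^{(2)},B_n^{(1)}$, $i=n$: $(x_n,x_0)\mapsto(x_n-1,1)$ if $x_0=0$; $(x_0,\bar x_n)\mapsto(0,\bar x_n+1)$ if $x_0=1$; - $A_{2n}^{(2)},C_n^{(1)},A_{2n-1}^{(2)}$, $i=n$: $(x_n,\bar x_n)\mapsto(x_n-1,\bar x_n+1)$; - $D_n^{(1)}$, $i=n-1$: $(x_{n-1},x_n)\mapsto(x_{n-1}-1,x_n+1)$ if $\bar x_n=0$; $(\bar x_n,\bar x_{n-1})\mapsto(\bar x_n-1,\bar x_{n-1}+1)$ if $x_n=0,\bar x_n\ge1$; $i=n$: $(x_n,\bar x_{n-1})\mapsto(x_n-1,\bar x_{n-1}+1)$ if $x_n\ge1,\bar x_n=0$; $(x_{n-1},\bar x_n)\mapsto(x_{n-1}-1,\bar x_n+1)$ if $x_n=0$. $\tilde e_ib=b'$ if and only if $\tilde f_ib'=b$. The functions $\varepsilon_i,\varphi_i$ on $\mathcal B^{(l)}$ are given by the same formulas in the coordinates as displayed under "Counting" for $\epsilon_i,\phi_i$ (with $l'$ as there), and $\mathrm{wt}(b)=\sum_i(\varphi_i(b)-\varepsilon_i(b))\Lambda_i$. *)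

theory Defs
  imports Complex_Main "HOL-Library.Multiset" "HOL-Library.Poly_Mapping"
begin

section \<open>Affine types\<close>

text \<open>
  The constructors stand for the families A(2n,2), D(n+1,2), A(2n-1,2), D(n,1), B(n,1), C(n,1),
  where the second entry is the superscript (order of the twist). The parameter \<open>n\<close> is
  carried separately, and the index set is \<open>I = {0..n}\<close>.
\<close>

datatype affine_type = A2_even | D2 | A2_odd | D1 | B1 | C1

fun admissible :: "affine_type \<Rightarrow> nat \<Rightarrow> bool" where
  "admissible A2_even n \<longleftrightarrow> n \<ge> 1"
| "admissible D2 n \<longleftrightarrow> n \<ge> 2"
| "admissible A2_odd n \<longleftrightarrow> n \<ge> 3"
| "admissible D1 n \<longleftrightarrow> n \<ge> 4"
| "admissible B1 n \<longleftrightarrow> n \<ge> 3"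
| "admissible C1 n \<longleftrightarrow> n \<ge> 2"

text \<open>The bottom layer of the stacking pattern is (0,0) for the following types and (0,1) for
  the others.\<close>

definition bottom_00 :: "affine_type \<Rightarrow> bool" where
  "bottom_00 T \<longleftrightarrow> T \<in> {A2_even, D2, C1}"

text \<open>The indices at which the Kashiwara operators have the same shape in all types.\<close>

fun generic_index :: "affine_type \<Rightarrow> nat \<Rightarrow> nat \<Rightarrow> bool" where
  "generic_index A2_even n i \<longleftrightarrow> 1 \<le> i \<and> i < n"
| "generic_index D2 n i \<longleftrightarrow> 1 \<le> i \<and> i < n"
| "generic_index C1 n i \<longleftrightarrow> 1 \<le> i \<and> i < n"
| "generic_index A2_odd n i \<longleftrightarrow> 2 \<le> i \<and> i < n"
| "generic_index B1 n i \<longleftrightarrow> 2 \<le> i \<and> i < n"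
| "generic_index D1 n i \<longleftrightarrow> 2 \<le> i \<and> i + 2 \<le> n"

definition width :: "affine_type \<Rightarrow> nat \<Rightarrow> nat" where
  "width T l = (if T = C1 then 2 * l else l)"

section \<open>Crystals\<close>

text \<open>The value \<open>None\<close> of a Kashiwara operator stands for the extra element 0. A weight is an
  element of the free abelian group on the \<open>\<Lambda>\<^sub>i\<close>, with \<open>Poly_Mapping.single i 1\<close> for \<open>\<Lambda>\<^sub>i\<close>.\<close>

record 'b crystal =
  elements :: "'b set"
  op_e :: "nat \<Rightarrow> 'b \<Rightarrow> 'b option"
  op_f :: "nat \<Rightarrow> 'b \<Rightarrow> 'b option"
  eps :: "nat \<Rightarrow> 'b \<Rightarrow> int"
  phi :: "nat \<Rightarrow> 'b \<Rightarrow> int"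
  wt :: "'b \<Rightarrow> nat \<Rightarrow>\<^sub>0 int"

text \<open>The operators are maps from the crystal to the crystal together with 0, and
  \<open>e\<^sub>i b = b'\<close> iff \<open>f\<^sub>i b' = b\<close>.\<close>

definition kashiwara_operators :: "nat set \<Rightarrow> 'b crystal \<Rightarrow> bool" where
  "kashiwara_operators I A \<longleftrightarrow> (\<forall>i\<in>I. \<forall>b\<in>elements A.
     op_e A i b \<in> insert None (Some ` elements A) \<and>
     op_f A i b \<in> insert None (Some ` elements A) \<and>
     (\<forall>b'\<in>elements A. op_e A i b = Some b' \<longleftrightarrow> op_f A i b' = Some b))"

definition crystal_iso :: "nat set \<Rightarrow> 'a crystal \<Rightarrow> 'b crystal \<Rightarrow> ('a \<Rightarrow> 'b) \<Rightarrow> bool" where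
  "crystal_iso I A B \<Phi> \<longleftrightarrow>
     kashiwara_operators I A \<and> kashiwara_operators I B \<and>
     bij_betw \<Phi> (elements A) (elements B) \<and>
     (\<forall>b\<in>elements A.
        wt B (\<Phi> b) = wt A b \<and>
        (\<forall>i\<in>I. op_e B i (\<Phi> b) = map_option \<Phi> (op_e A i b) \<and>
               op_f B i (\<Phi> b) = map_option \<Phi> (op_f A i b) \<and>
               eps B i (\<Phi> b) = eps A i b \<and>
               phi B i (\<Phi> b) = phi A i b))"

text \<open>The operator \<open>e\<close> determined by \<open>f\<close> on the set \<open>X\<close>.\<close>

definition inverse_operator :: "'b set \<Rightarrow> ('b \<Rightarrow> 'b option) \<Rightarrow> 'b \<Rightarrow> 'b option" where
  "inverse_operator X f b =
     (if \<exists>b'\<in>X. f b' = Some b then Some (THE b'. b' \<in> X \<and> f b' = Some b) else None)"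

section \<open>Vectors and counting functions\<close>

text \<open>
  \<open>S i\<close> and \<open>Sbar i\<close> label both the coordinates \<open>x\<^sub>i\<close>, \<open>\<bar>x\<^sub>i\<close> of vectors and the slice classes
  \<open>s\<^sub>i\<close>, \<open>\<bar>s\<^sub>i\<close>; \<open>S0\<close> labels \<open>x\<^sub>0\<close> and \<open>s\<^sub>0\<close>; \<open>Star\<close> is only a slice class.
\<close>

datatype label = Star | S nat | S0 | Sbar nat

type_synonym vector = "label \<Rightarrow> int"

definition coordinates :: "affine_type \<Rightarrow> nat \<Rightarrow> label set" where
  "coordinates T n = S ` {1..n} \<union> Sbar ` {1..n} \<union> (if T = D2 \<or> T = B1 then {S0} else {})"

definition total :: "affine_type \<Rightarrow> nat \<Rightarrow> vector \<Rightarrow> int" where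
  "total T n x = (\<Sum>c\<in>coordinates T n. x c)"

definition pos :: "int \<Rightarrow> int" where
  "pos a = max 0 a"

text \<open>Here \<open>m\<close> is \<open>l'\<close>, which is only relevant if \<open>bottom_00 T\<close> (it is even in type \<open>C1\<close>). In the
  last branch, \<open>T = D1\<close> and \<open>i = n - 1\<close>.\<close>

definition eps_formula :: "affine_type \<Rightarrow> nat \<Rightarrow> int \<Rightarrow> vector \<Rightarrow> nat \<Rightarrow> int" where
  "eps_formula T n m x i =
    (if generic_index T n i then x (Sbar i) + pos (x (S (i + 1)) - x (Sbar (i + 1)))
     else if i = 0 then
       (if T = C1 then m div 2 + pos (x (S 1) - x (Sbar 1))
        else if bottom_00 T then m + 2 * pos (x (S 1) - x (Sbar 1))
        else x (S 1) + pos (x (S 2) - x (Sbar 2)))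
     else if i = n then
       (if T = D1 then x (Sbar (n - 1)) + x (Sbar n)
        else if T = D2 \<or> T = B1 then 2 * x (Sbar n) + x S0
        else x (Sbar n))
     else if i = 1 then x (Sbar 1) + pos (x (S 2) - x (Sbar 2))
     else x (Sbar (n - 1)) + x (S n))"

definition phi_formula :: "affine_type \<Rightarrow> nat \<Rightarrow> int \<Rightarrow> vector \<Rightarrow> nat \<Rightarrow> int" where
  "phi_formula T n m x i =
    (if generic_index T n i then x (S i) + pos (x (Sbar (i + 1)) - x (S (i + 1)))
     else if i = 0 then
       (if T = C1 then m div 2 + pos (x (Sbar 1) - x (S 1))
        else if bottom_00 T then m + 2 * pos (x (Sbar 1) - x (S 1))
        else x (Sbar 1) + pos (x (Sbar 2) - x (S 2)))
     else if i = n then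
       (if T = D1 then x (S (n - 1)) + x (S n)
        else if T = D2 \<or> T = B1 then 2 * x (S n) + x S0
        else x (S n))
     else if i = 1 then x (S 1) + pos (x (Sbar 2) - x (S 2))
     else x (S (n - 1)) + x (Sbar n))"

definition weight :: "nat \<Rightarrow> (nat \<Rightarrow> int) \<Rightarrow> (nat \<Rightarrow> int) \<Rightarrow> nat \<Rightarrow>\<^sub>0 int" where
  "weight n ph ep = (\<Sum>i\<in>{0..n}. Poly_Mapping.single i (ph i - ep i))"

section \<open>The perfect crystal\<close>

fun level_condition :: "affine_type \<Rightarrow> nat \<Rightarrow> nat \<Rightarrow> vector \<Rightarrow> bool" where
  "level_condition A2_even n l b \<longleftrightarrow> total A2_even n b \<le> int l"
| "level_condition D2 n l b \<longleftrightarrow> b S0 \<in> {0, 1} \<and> total D2 n b \<le> int l"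
| "level_condition C1 n l b \<longleftrightarrow> even (total C1 n b) \<and> total C1 n b \<le> 2 * int l"
| "level_condition A2_odd n l b \<longleftrightarrow> total A2_odd n b = int l"
| "level_condition D1 n l b \<longleftrightarrow> total D1 n b = int l \<and> (b (S n) = 0 \<or> b (Sbar n) = 0)"
| "level_condition B1 n l b \<longleftrightarrow> b S0 \<in> {0, 1} \<and> total B1 n b = int l"

text \<open>Vectors are extended by 0 outside their coordinates.\<close>

definition perfect_set :: "affine_type \<Rightarrow> nat \<Rightarrow> nat \<Rightarrow> vector set" where
  "perfect_set T n l =
     {b. (\<forall>c. b c \<ge> 0) \<and> (\<forall>c. c \<notin> coordinates T n \<longrightarrow> b c = 0) \<and> level_condition T n l b}"

definition l_prime :: "affine_type \<Rightarrow> nat \<Rightarrow> nat \<Rightarrow> vector \<Rightarrow> int" where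
  "l_prime T n l b = int (width T l) - total T n b"

text \<open>The result of \<open>f\<^sub>i\<close> as an integer vector, before testing whether it lies in the crystal.
  In the last branch, \<open>T = D1\<close> and \<open>i = n - 1\<close>.\<close>

definition perfect_move :: "affine_type \<Rightarrow> nat \<Rightarrow> nat \<Rightarrow> vector \<Rightarrow> vector" where
  "perfect_move T n i b =
    (if generic_index T n i then
       (if b (S (i + 1)) \<ge> b (Sbar (i + 1))
        then b(S i := b (S i) - 1, S (i + 1) := b (S (i + 1)) + 1)
        else b(Sbar (i + 1) := b (Sbar (i + 1)) - 1, Sbar i := b (Sbar i) + 1))
     else if i = 0 then
       (if T = C1 then
          (if b (S 1) \<ge> b (Sbar 1) then b(S 1 := b (S 1) + 2)
           else if b (S 1) = b (Sbar 1) - 1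
           then b(S 1 := b (S 1) + 1, Sbar 1 := b (Sbar 1) - 1)
           else b(Sbar 1 := b (Sbar 1) - 2))
        else if bottom_00 T then
          (if b (S 1) \<ge> b (Sbar 1) then b(S 1 := b (S 1) + 1)
           else b(Sbar 1 := b (Sbar 1) - 1))
        else
          (if b (S 2) \<ge> b (Sbar 2)
           then b(S 2 := b (S 2) + 1, Sbar 1 := b (Sbar 1) - 1)
           else b(S 1 := b (S 1) + 1, Sbar 2 := b (Sbar 2) - 1)))
     else if i = n then
       (if T = D1 then
          (if b (S n) \<ge> 1 \<and> b (Sbar n) = 0
           then b(S n := b (S n) - 1, Sbar (n - 1) := b (Sbar (n - 1)) + 1)
           else b(S (n - 1) := b (S (n - 1)) - 1, Sbar n := b (Sbar n) + 1))
        else if T = D2 \<or> T = B1 then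
          (if b S0 = 0 then b(S n := b (S n) - 1, S0 := 1)
           else b(S0 := 0, Sbar n := b (Sbar n) + 1))
        else b(S n := b (S n) - 1, Sbar n := b (Sbar n) + 1))
     else if i = 1 then
       (if b (S 2) \<ge> b (Sbar 2)
        then b(S 1 := b (S 1) - 1, S 2 := b (S 2) + 1)
        else b(Sbar 2 := b (Sbar 2) - 1, Sbar 1 := b (Sbar 1) + 1))
     else
       (if b (Sbar n) = 0
        then b(S (n - 1) := b (S (n - 1)) - 1, S n := b (S n) + 1)
        else b(Sbar n := b (Sbar n) - 1, Sbar (n - 1) := b (Sbar (n - 1)) + 1)))"

definition perfect_f :: "affine_type \<Rightarrow> nat \<Rightarrow> nat \<Rightarrow> nat \<Rightarrow> vector \<Rightarrow> vector option" where
  "perfect_f T n l i b =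
     (let b' = perfect_move T n i b in if b' \<in> perfect_set T n l then Some b' else None)"

definition perfect_crystal :: "affine_type \<Rightarrow> nat \<Rightarrow> nat \<Rightarrow> vector crystal" where
  "perfect_crystal T n l =
    (let ep = (\<lambda>i b. eps_formula T n (l_prime T n l b) b i);
         ph = (\<lambda>i b. phi_formula T n (l_prime T n l b) b i)
     in \<lparr> elements = perfect_set T n l,
          op_e = (\<lambda>i. inverse_operator (perfect_set T n l) (perfect_f T n l i)),
          op_f = perfect_f T n l,
          eps = ep,
          phi = ph,
          wt = (\<lambda>b. weight n (\<lambda>i. ph i b) (\<lambda>i. ep i b)) \<rparr>)"

section \<open>Layers, slices and Young columns\<close>

text \<open>\<open>Whole i\<close> is a unit-depth \<open>i\<close>-block; \<open>Halves a b\<close> is a layer of half-depth blocks with \<open>a\<close>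
  in front and \<open>b\<close> at the back, where \<open>None\<close> means that the block is absent. A slice is the list
  of its layers from bottom to top, a column the list of its slices from left to right.\<close>

datatype layer = Whole nat | Halves "nat option" "nat option"

type_synonym slice = "layer list"
type_synonym column = "slice list"

abbreviation two :: "nat \<Rightarrow> nat \<Rightarrow> layer" where
  "two a b \<equiv> Halves (Some a) (Some b)"

fun delta_slice :: "affine_type \<Rightarrow> nat \<Rightarrow> slice" where
  "delta_slice A2_even n = [two 0 0] @ map Whole [1..<n] @ [Whole n] @ map Whole (rev [1..<n])"
| "delta_slice C1 n = [two 0 0] @ map Whole [1..<n] @ [Whole n] @ map Whole (rev [1..<n])"
| "delta_slice D2 n = [two 0 0] @ map Whole [1..<n] @ [two n n] @ map Whole (rev [1..<n])"
| "delta_slice A2_odd n = [two 0 1] @ map Whole [2..<n] @ [Whole n] @ map Whole (rev [2..<n])"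
| "delta_slice D1 n =
     [two 0 1] @ map Whole [2..<n - 1] @ [two (n - 1) n] @ map Whole (rev [2..<n - 1])"
| "delta_slice B1 n = [two 0 1] @ map Whole [2..<n] @ [two n n] @ map Whole (rev [2..<n])"

definition pattern :: "affine_type \<Rightarrow> nat \<Rightarrow> nat \<Rightarrow> layer" where
  "pattern T n h = delta_slice T n ! (h mod length (delta_slice T n))"

text \<open>The incomplete states of a layer. If both half-depth blocks have the same colour, then the
  one at the back is placed first.\<close>

fun half_filled :: "layer \<Rightarrow> layer set" where
  "half_filled (Halves (Some a) (Some b)) =
     (if a = b then {Halves None (Some b)} else {Halves (Some a) None, Halves None (Some b)})"
| "half_filled _ = {}"

definition stacked :: "affine_type \<Rightarrow> nat \<Rightarrow> slice \<Rightarrow> bool" where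
  "stacked T n s \<longleftrightarrow> (\<forall>h<length s. s ! h = pattern T n h \<or>
     Suc h = length s \<and> s ! h \<in> half_filled (pattern T n h))"

fun layer_size :: "layer \<Rightarrow> nat" where
  "layer_size (Whole i) = 1"
| "layer_size (Halves a b) = (if a = None then 0 else 1) + (if b = None then 0 else 1)"

definition num_blocks :: "slice \<Rightarrow> nat" where
  "num_blocks s = sum_list (map layer_size s)"

definition young_column :: "affine_type \<Rightarrow> nat \<Rightarrow> nat \<Rightarrow> column \<Rightarrow> bool" where
  "young_column T n l C \<longleftrightarrow> length C = width T l \<and> (\<forall>s\<in>set C. stacked T n s) \<and>
     sorted (map num_blocks C)"

definition reduced :: "affine_type \<Rightarrow> nat \<Rightarrow> column \<Rightarrow> bool" where
  "reduced T n C \<longleftrightarrow> (\<forall>s\<in>set C. length s \<le> length (delta_slice T n))"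

section \<open>Reduced Young columns\<close>

text \<open>The slices \<open>s\<^sub>*\<close>, \<open>s\<^sub>i\<close>, \<open>s\<^sub>0\<close>, \<open>\<bar>s\<^sub>i\<close>. The complete slices \<open>\<bar>s\<^sub>i\<close> are given by
  their number of layers: counting the descending part from the top, the last \<open>i\<close>-layer is followed
  by the layers \<open>i - 1, \<dots>, 1\<close>, respectively \<open>i - 1, \<dots>, 2\<close>.\<close>

definition slice_of :: "affine_type \<Rightarrow> nat \<Rightarrow> label \<Rightarrow> slice" where
  "slice_of T n c =
    (let d = delta_slice T n in
     if bottom_00 T then
       (case c of
          Star \<Rightarrow> [Halves None (Some 0)]
        | S i \<Rightarrow> [two 0 0] @ map Whole [1..<i]
        | S0 \<Rightarrow> [two 0 0] @ map Whole [1..<n] @ [Halves None (Some n)]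
        | Sbar i \<Rightarrow> take (length d - (i - 1)) d)
     else
       (case c of
          Star \<Rightarrow> []
        | S i \<Rightarrow>
            if i = 1 then [Halves (Some 0) None]
            else if T = D1 \<and> i = n then [two 0 1] @ map Whole [2..<n - 1] @ [Halves (Some (n - 1)) None]
            else [two 0 1] @ map Whole [2..<i]
        | S0 \<Rightarrow> [two 0 1] @ map Whole [2..<n] @ [Halves None (Some n)]
        | Sbar i \<Rightarrow>
            if i = 1 then [Halves None (Some 1)]
            else if T = D1 \<and> i = n then [two 0 1] @ map Whole [2..<n - 1] @ [Halves None (Some n)]
            else take (length d - (i - 2)) d))"

definition classes :: "affine_type \<Rightarrow> nat \<Rightarrow> label list" where
  "classes T n =
    (let mid = (if T = D2 \<or> T = B1 then [S0] else []) in
     if bottom_00 T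
     then [Star] @ map S [1..<n + 1] @ mid @ map Sbar (rev [1..<n + 1])
     else [S 1, Sbar 1] @ map S [2..<n + 1] @ mid @ map Sbar (rev [2..<n + 1]))"

definition multiplicity_of :: "affine_type \<Rightarrow> nat \<Rightarrow> nat \<Rightarrow> vector \<Rightarrow> label \<Rightarrow> nat" where
  "multiplicity_of T n l b c = nat (if c = Star then l_prime T n l b else b c)"

definition column_of :: "affine_type \<Rightarrow> nat \<Rightarrow> nat \<Rightarrow> vector \<Rightarrow> column" where
  "column_of T n l b =
     concat (map (\<lambda>c. replicate (multiplicity_of T n l b c) (slice_of T n c)) (classes T n))"

definition column_set :: "affine_type \<Rightarrow> nat \<Rightarrow> nat \<Rightarrow> column set" where
  "column_set T n l = column_of T n l ` perfect_set T n l"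

text \<open>The number of slices of each class in a column.\<close>

definition counts :: "affine_type \<Rightarrow> nat \<Rightarrow> column \<Rightarrow> vector" where
  "counts T n C c = int (count_list C (slice_of T n c))"

subsection \<open>The columns \<open>C\<^sub>b\<close> are reduced Young columns of level \<open>l\<close>\<close>

lemma length_delta: "admissible T n \<Longrightarrow>
  length (delta_slice T n) = (if bottom_00 T then 2 * n else if T = D1 then 2 * n - 4 else 2 * n - 2)"
  by (cases T) (auto simp: bottom_00_def)

lemma stacked_take:
  assumes "k \<le> length (delta_slice T n)" 
  shows "stacked T n (take k (delta_slice T n))"
  using assms by (auto simp: stacked_def pattern_def)

lemma stacked_half:
  assumes "k < length (delta_slice T n)" and "L \<in> half_filled (delta_slice T n ! k)"
  shows "stacked T n (take k (delta_slice T n) @ [L])"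
  using assms by (auto simp: stacked_def pattern_def nth_append less_Suc_eq)

lemma num_blocks_append [simp]: "num_blocks (s @ t) = num_blocks s + num_blocks t"
  by (simp add: num_blocks_def)

lemma num_blocks_Cons [simp]: "num_blocks (L # s) = layer_size L + num_blocks s"
  by (simp add: num_blocks_def)

lemma num_blocks_Nil [simp]: "num_blocks [] = 0"
  by (simp add: num_blocks_def)

lemma num_blocks_Whole [simp]: "num_blocks (map Whole xs) = length xs"
  by (induction xs) auto

lemma slice_of_00:
  assumes "bottom_00 T" "admissible T n" "1 \<le> i" "i \<le> n"
  shows "slice_of T n (S i) = take i (delta_slice T n)"
  using assms by (cases T) (auto simp: slice_of_def bottom_00_def take_Cons' take_map numeral_2_eq_2 min_def)

lemma slice_of_01:
  assumes "\<not> bottom_00 T" "admissible T n" "2 \<le> i" "i \<le> n" "T = D1 \<Longrightarrow> i < n"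
  shows "slice_of T n (S i) = take (i - 1) (delta_slice T n)"
proof -
  obtain j where "i = Suc (Suc j)"
    using assms(3) by (metis add_2_eq_Suc le_Suc_ex)
  then show ?thesis
    using assms by (cases T) (auto simp: slice_of_def bottom_00_def take_map min_def)
qed

lemma stacked_slice_of:
  assumes "admissible T n" and "c \<in> set (classes T n)"
  shows "stacked T n (slice_of T n c) \<and> length (slice_of T n c) \<le> length (delta_slice T n)"
proof -
  let ?d = "delta_slice T n"
  have full: ?thesis if "k \<le> length ?d" "slice_of T n c = take k ?d" for k
    using stacked_take that by simp
  have half: ?thesis
    if "k < length ?d" "slice_of T n c = take k ?d @ [L]" "L \<in> half_filled (?d ! k)" for k L
    using stacked_half that by simp
  note len = length_delta[OF assms(1)]
  show ?thesis
  proof (cases "bottom_00 T")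
    case True
    show ?thesis
    proof (cases c)
      case Star
      show ?thesis
        using True assms Star by (intro half[of 0]) (cases T; auto simp: slice_of_def bottom_00_def)+
    next
      case (S i)
      then have "1 \<le> i" "i \<le> n" using assms True by (auto simp: classes_def)
      then show ?thesis using full[of i] slice_of_00 True assms S len by simp
    next
      case S0
      then have "T = D2" using assms True by (auto simp: classes_def bottom_00_def split: if_splits)
      then show ?thesis
        using S0 assms by (intro half[of n]) (auto simp: slice_of_def bottom_00_def nth_append nth_Cons' take_Cons')
    next
      case (Sbar i)
      then show ?thesis using True by (intro full[of "length ?d - (i - 1)"]) (auto simp: slice_of_def Let_def)
    qed
  next
    case False
    show ?thesis
    proof (cases c)
      case Star
      then show ?thesis using assms False by (auto simp: classes_def split: if_splits)
    next
      case (S i)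
      consider "i = 1" | "T = D1" "i = n" | "2 \<le> i" "i \<le> n" "T = D1 \<Longrightarrow> i < n"
        using S assms False by (fastforce simp: classes_def split: if_splits)
      then show ?thesis
      proof cases
        case 1
        then show ?thesis
          using S False assms by (intro half[of 0]) (cases T; auto simp: slice_of_def bottom_00_def)+
      next
        case 2
        then show ?thesis
          using S False assms
          by (intro half[of "n - 2"]) (auto simp: slice_of_def bottom_00_def nth_append nth_Cons' take_Cons')
      next
        case 3
        then show ?thesis using full[of "i - 1"] slice_of_01[OF False assms(1), of i] S len assms(1) False
          by (cases T) auto
      qed
    next
      case S0
      then have "T = B1" using assms False by (auto simp: classes_def bottom_00_def split: if_splits)
      then show ?thesis
        using S0 assms by (intro half[of "n - 1"]) (auto simp: slice_of_def bottom_00_def nth_append nth_Cons' take_Cons')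
    next
      case (Sbar i)
      consider "i = 1" | "T = D1" "i = n" | "2 \<le> i" "i \<le> n" "T = D1 \<Longrightarrow> i < n"
        using Sbar assms False by (fastforce simp: classes_def split: if_splits)
      then show ?thesis
      proof cases
        case 1
        then show ?thesis
          using Sbar False assms by (intro half[of 0]) (cases T; auto simp: slice_of_def bottom_00_def)+
      next
        case 2
        then show ?thesis
          using Sbar False assms
          by (intro half[of "n - 2"]) (auto simp: slice_of_def bottom_00_def nth_append nth_Cons' take_Cons')
      next
        case 3
        then show ?thesis
          using Sbar False by (intro full[of "length ?d - (i - 2)"]) (auto simp: slice_of_def Let_def)
      qed
    qed
  qed
qed


lemma num_blocks_take:
  assumes "m \<le> length xs"
  shows "num_blocks (take (length (t @ map Whole xs) - m) (t @ map Whole xs))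
         = num_blocks t + length xs - m"
  using assms by (simp add: take_map)

fun class_size :: "affine_type \<Rightarrow> nat \<Rightarrow> label \<Rightarrow> nat" where
  "class_size T n Star = 1"
| "class_size T n (S i) = (if bottom_00 T then i + 1 else i)"
| "class_size T n S0 = (if bottom_00 T then n + 2 else n + 1)"
| "class_size T n (Sbar i) =
    (if \<not> bottom_00 T \<and> i = 1 then 1
     else 2 * n - i + (if T = D2 then 3 else if T = D1 then 0 else if T = A2_odd then 1 else 2))"

lemma num_blocks_slice_of:
  assumes "admissible T n" and "c \<in> set (classes T n)"
  shows "num_blocks (slice_of T n c) = class_size T n c"
proof (cases c)
  case (Sbar i)
  then have i: "1 \<le> i" "i \<le> n" using assms by (cases T; auto simp: classes_def bottom_00_def)+
  show ?thesis
  proof (cases T)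
    case A2_even
    then show ?thesis
      using i Sbar num_blocks_take[of "i - 1" "rev [1..<n]" "[two 0 0] @ map Whole [1..<n] @ [Whole n]"]
      by (simp add: slice_of_def bottom_00_def)
  next
    case D2
    then show ?thesis
      using i Sbar num_blocks_take[of "i - 1" "rev [1..<n]" "[two 0 0] @ map Whole [1..<n] @ [two n n]"]
      by (simp add: slice_of_def bottom_00_def)
  next
    case C1
    then show ?thesis
      using i Sbar num_blocks_take[of "i - 1" "rev [1..<n]" "[two 0 0] @ map Whole [1..<n] @ [Whole n]"]
      by (simp add: slice_of_def bottom_00_def)
  next
    case A2_odd
    then show ?thesis
      using i Sbar assms num_blocks_take[of "i - 2" "rev [2..<n]" "[two 0 1] @ map Whole [2..<n] @ [Whole n]"]
      by (cases "i = 1") (simp_all add: slice_of_def bottom_00_def)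
  next
    case B1
    then show ?thesis
      using i Sbar assms num_blocks_take[of "i - 2" "rev [2..<n]" "[two 0 1] @ map Whole [2..<n] @ [two n n]"]
      by (cases "i = 1") (simp_all add: slice_of_def bottom_00_def)
  next
    case D1
    then show ?thesis
      using i Sbar assms num_blocks_take[of "i - 2" "rev [2..<n - 1]" "[two 0 1] @ map Whole [2..<n - 1] @ [two (n - 1) n]"]
      by (cases "i = 1"; cases "i = n") (simp_all add: slice_of_def bottom_00_def)
  qed
qed (use assms in \<open>(cases T; auto simp: slice_of_def classes_def bottom_00_def)+\<close>)

lemma sorted_class_size:
  assumes "admissible T n"
  shows "sorted (map (class_size T n) (classes T n))"
  using assms
  by (cases T) (auto simp: classes_def bottom_00_def Let_def sorted_append sorted_map sorted_wrt_rev
      comp_def rev_map[symmetric] sorted_wrt_map simp del: upt_Suc intro: sorted_wrt_mono_rel[of _ "(<)"])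

lemma sorted_concat_replicate:
  assumes "sorted (map g cs)" and "\<And>c. c \<in> set cs \<Longrightarrow> h (f c) = (g c :: nat)"
  shows "sorted (map h (concat (map (\<lambda>c. replicate (m c) (f c)) cs)))"
  using assms by (induction cs) (auto simp: sorted_append)

lemma sum_classes:
  assumes "admissible T n"
  shows "(\<Sum>c\<leftarrow>classes T n. y c) = (\<Sum>c\<in>coordinates T n. y c) + (if bottom_00 T then y Star else (0::int))"
proof -
  have "distinct (classes T n)"
    using assms by (cases T) (auto simp: classes_def bottom_00_def distinct_map inj_on_def simp del: upt_Suc)
  moreover have "set (classes T n) = coordinates T n \<union> (if bottom_00 T then {Star} else {})"
    using assms
    by (cases T) (force simp: classes_def coordinates_def bottom_00_def simp del: upt_Suc)+
  moreover have "finite (coordinates T n)" "Star \<notin> coordinates T n"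
    by (auto simp: coordinates_def)
  ultimately show ?thesis by (auto simp: sum_list_distinct_conv_sum_set)
qed

theorem column_set_young_reduced:
  assumes "admissible T n" and "C \<in> column_set T n l"
  shows "young_column T n l C \<and> reduced T n C"
proof -
  from assms(2) obtain b where b: "b \<in> perfect_set T n l" and C: "C = column_of T n l b"
    by (auto simp: column_set_def)
  have nonneg: "b c \<ge> 0" for c using b by (simp add: perfect_set_def)
  have lp: "l_prime T n l b \<ge> 0" "\<not> bottom_00 T \<Longrightarrow> l_prime T n l b = 0"
    using b by (cases T; auto simp: perfect_set_def l_prime_def width_def bottom_00_def)+
  have "int (length C) = (\<Sum>c\<leftarrow>classes T n. int (multiplicity_of T n l b c))"
    unfolding C column_of_def by (simp add: length_concat comp_def flip: sum_list_of_nat)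
  also have "\<dots> = (\<Sum>c\<in>coordinates T n. int (multiplicity_of T n l b c)) +
      (if bottom_00 T then int (multiplicity_of T n l b Star) else 0)"
    by (rule sum_classes[OF assms(1)])
  also have "(\<Sum>c\<in>coordinates T n. int (multiplicity_of T n l b c)) = total T n b"
    unfolding total_def by (rule sum.cong) (auto simp: multiplicity_of_def coordinates_def nonneg split: if_splits)
  also have "total T n b + (if bottom_00 T then int (multiplicity_of T n l b Star) else 0)
      = int (width T l)"
    using lp by (auto simp: multiplicity_of_def l_prime_def)
  finally have "length C = width T l" by simp
  moreover have "sorted (map num_blocks C)"
    unfolding C column_of_def
    by (rule sorted_concat_replicate[OF sorted_class_size[OF assms(1)]])
      (rule num_blocks_slice_of[OF assms(1)])
  moreover have "\<forall>s\<in>set C. stacked T n s \<and> length s \<le> length (delta_slice T n)"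
    using stacked_slice_of[OF assms(1)] unfolding C column_of_def by auto
  ultimately show ?thesis by (auto simp: young_column_def reduced_def)
qed

section \<open>Operators on Young columns\<close>

text \<open>Placing an \<open>i\<close>-block into a layer with the pattern given by the first argument, which is
  empty (\<open>start_layer\<close>) or in a half-filled state (\<open>fill_layer\<close>).\<close>

fun start_layer :: "layer \<Rightarrow> nat \<Rightarrow> layer option" where
  "start_layer (Whole j) i = (if i = j then Some (Whole i) else None)"
| "start_layer (Halves a b) i =
     (if b = Some i then Some (Halves None (Some i))
      else if a = Some i then Some (Halves (Some i) None)
      else None)"

fun fill_layer :: "layer \<Rightarrow> nat \<Rightarrow> layer \<Rightarrow> layer option" where
  "fill_layer (Halves a b) i (Halves None b') =
     (if a = Some i then Some (Halves (Some i) b') else None)"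
| "fill_layer (Halves a b) i (Halves a' None) =
     (if b = Some i then Some (Halves a' (Some i)) else None)"
| "fill_layer _ _ _ = None"

definition add_block :: "affine_type \<Rightarrow> nat \<Rightarrow> nat \<Rightarrow> slice \<Rightarrow> slice option" where
  "add_block T n i s =
    (let h = length s - 1 in
     if s \<noteq> [] \<and> last s \<in> half_filled (pattern T n h)
     then map_option (\<lambda>L. butlast s @ [L]) (fill_layer (pattern T n h) i (last s))
     else map_option (\<lambda>L. s @ [L]) (start_layer (pattern T n (length s)) i))"

text \<open>Adding an \<open>i\<close>-block (or two, for \<open>add2_rightmost\<close>) to the rightmost slice of class \<open>c\<close>.\<close>

definition rightmost :: "slice \<Rightarrow> column \<Rightarrow> nat" where
  "rightmost s C = Max {p. p < length C \<and> C ! p = s}"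

definition add_rightmost ::
  "affine_type \<Rightarrow> nat \<Rightarrow> nat \<Rightarrow> label \<Rightarrow> column \<Rightarrow> column option" where
  "add_rightmost T n i c C =
    (let s = slice_of T n c in
     if s \<in> set C then map_option (\<lambda>s'. C[rightmost s C := s']) (add_block T n i s) else None)"

definition add2_rightmost ::
  "affine_type \<Rightarrow> nat \<Rightarrow> nat \<Rightarrow> label \<Rightarrow> column \<Rightarrow> column option" where
  "add2_rightmost T n i c C =
    (let s = slice_of T n c in
     if s \<in> set C
     then map_option (\<lambda>s'. C[rightmost s C := s'])
            (Option.bind (add_block T n i s) (add_block T n i))
     else None)"

text \<open>The column with the new block, before the removal of \<open>\<delta>\<close>-slices. In the last branch,
  \<open>T = D1\<close> and \<open>i = n - 1\<close>.\<close>

definition add_to_column :: "affine_type \<Rightarrow> nat \<Rightarrow> nat \<Rightarrow> column \<Rightarrow> column option" where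
  "add_to_column T n i C =
    (let x = counts T n C; add = (\<lambda>c. add_rightmost T n i c) in
     if generic_index T n i then
       (if x (S (i + 1)) \<ge> x (Sbar (i + 1)) then add (S i) C else add (Sbar (i + 1)) C)
     else if i = 0 then
       (if T = C1 then
          (if x (S 1) \<ge> x (Sbar 1) then Option.bind (add Star C) (add Star)
           else if x (S 1) = x (Sbar 1) - 1 then add2_rightmost T n i (Sbar 1) C
           else Option.bind (add (Sbar 1) C) (add (Sbar 1)))
        else if bottom_00 T then
          (if x (S 1) \<ge> x (Sbar 1) then add Star C else add (Sbar 1) C)
        else
          (if x (S 2) \<ge> x (Sbar 2) then add (Sbar 1) C else add (Sbar 2) C))
     else if i = n then
       (if T = D1 then
          (if x (S n) \<ge> 1 \<and> x (Sbar n) = 0 then add (S n) C else add (S (n - 1)) C)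
        else if T = D2 \<or> T = B1 then
          (if x S0 = 0 then add (S n) C else add S0 C)
        else add (S n) C)
     else if i = 1 then
       (if x (S 2) \<ge> x (Sbar 2) then add (S 1) C else add (Sbar 2) C)
     else
       (if x (Sbar n) = 0 then add (S (n - 1)) C else add (Sbar n) C))"

text \<open>Removes as many \<open>\<delta>\<close>-slices from the bottom as is possible with at least one block remaining
  on top of each of them.\<close>

definition remove_delta :: "affine_type \<Rightarrow> nat \<Rightarrow> slice \<Rightarrow> slice" where
  "remove_delta T n s =
    (let p = length (delta_slice T n) in drop (p * ((length s - 1) div p)) s)"

definition rearrange :: "affine_type \<Rightarrow> nat \<Rightarrow> nat \<Rightarrow> column \<Rightarrow> column" where
  "rearrange T n l C = (THE C'. C' \<in> column_set T n l \<and> mset C' = mset C)"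

definition column_f :: "affine_type \<Rightarrow> nat \<Rightarrow> nat \<Rightarrow> nat \<Rightarrow> column \<Rightarrow> column option" where
  "column_f T n l i C =
     map_option (\<lambda>D. rearrange T n l (map (remove_delta T n) D)) (add_to_column T n i C)"

definition column_crystal :: "affine_type \<Rightarrow> nat \<Rightarrow> nat \<Rightarrow> column crystal" where
  "column_crystal T n l =
    (let ep = (\<lambda>i C. eps_formula T n (counts T n C Star) (counts T n C) i);
         ph = (\<lambda>i C. phi_formula T n (counts T n C Star) (counts T n C) i)
     in \<lparr> elements = column_set T n l,
          op_e = (\<lambda>i. inverse_operator (column_set T n l) (column_f T n l i)),
          op_f = column_f T n l,
          eps = ep,
          phi = ph,
          wt = (\<lambda>C. weight n (\<lambda>i. ph i C) (\<lambda>i. ep i C)) \<rparr>)"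

end

theory Submission
  imports Defs
begin

text \<open>
  A column is determined by the multiset of the classes of its slices, since distinct classes
  have distinct slices. In every case the operator \<open>f\<^sub>i\<close> on vectors transfers one or two units
  from one coordinate to another, where \<open>l'\<close> serves as the coordinate of the class \<open>s\<^sub>*\<close>; on
  columns, adding the block and removing a \<open>\<delta>\<close>-slice turns a slice of the first class into one
  of the second. Both operators are 0 precisely when there are not enough slices of the first
  class. Moreover \<open>f\<^sub>i\<close> is injective where it is nonzero, so that the operators \<open>e\<^sub>i\<close>
  correspond as well.
\<close>

section \<open>Slice classes\<close>

text \<open>The two operators become 0 for different reasons: \<open>column_f\<close> because no
  slice of the required class is present, \<open>perfect_f\<close> because the moved vector leaves
  \<open>perfect_set\<close>. The latter also imposes \<open>b S0 \<le> 1\<close>, a parity in type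
  \<open>C1\<close> and the vanishing of \<open>x\<^sub>n\<close> or \<open>\<bar>x\<^sub>n\<close>
  in type \<open>D1\<close>, so it has to be shown that the branch conditions protect all of these
  and that only the source coordinate can fail. A second obstacle is that \<open>rearrange\<close>
  and \<open>inverse_operator\<close> are definite descriptions. For the first, uniqueness comes
  from recovering a vector from the slice counts of its column. For the second it comes from
  injectivity of \<open>f\<^sub>i\<close>, which is piecewise a translation: the translation that
  was applied has to be recovered from the result alone. Type \<open>C1\<close> with
  \<open>i = 0\<close> shapes the definitions, since there one step may move two slices, or place
  both half-depth blocks on one slice.\<close>

lemma distinct_classes: "admissible T n \<Longrightarrow> distinct (classes T n)"
  by (cases T) (auto simp: classes_def bottom_00_def distinct_map inj_on_def simp del: upt_Suc)

lemma set_classes: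
  "admissible T n \<Longrightarrow> set (classes T n) = coordinates T n \<union> (if bottom_00 T then {Star} else {})"
  by (cases T) (force simp: classes_def coordinates_def bottom_00_def simp del: upt_Suc)+

lemma S_in_classes [simp]: "admissible T n \<Longrightarrow> S i \<in> set (classes T n) \<longleftrightarrow> 1 \<le> i \<and> i \<le> n"
  by (auto simp: set_classes coordinates_def)

lemma Sbar_in_classes [simp]: "admissible T n \<Longrightarrow> Sbar i \<in> set (classes T n) \<longleftrightarrow> 1 \<le> i \<and> i \<le> n"
  by (auto simp: set_classes coordinates_def)

lemma S0_in_classes [simp]: "admissible T n \<Longrightarrow> S0 \<in> set (classes T n) \<longleftrightarrow> T = D2 \<or> T = B1"
  by (auto simp: set_classes coordinates_def)

lemma Star_in_classes [simp]: "admissible T n \<Longrightarrow> Star \<in> set (classes T n) \<longleftrightarrow> bottom_00 T"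
  by (auto simp: set_classes coordinates_def)

lemma Star_not_coordinate [simp]: "Star \<notin> coordinates T n"
  by (auto simp: coordinates_def)

lemma classes_cases:
  assumes "admissible T n" and "c \<in> set (classes T n)"
  shows "(\<exists>i. c = S i \<and> 1 \<le> i \<and> i \<le> n) \<or> (\<exists>i. c = Sbar i \<and> 1 \<le> i \<and> i \<le> n)
    \<or> c = S0 \<and> (T = D2 \<or> T = B1) \<or> c = Star \<and> bottom_00 T"
  using assms by (cases c rule: label.exhaust) simp_all

text \<open>An explicit inverse relation to \<open>class_size\<close>, with \<open>k\<close> the
  same offset as there. A number of blocks fixes the class except for two pairs whose members end in
  different halves of one layer: \<open>S 1\<close>, \<open>Sbar 1\<close> over (0,1), and
  \<open>S n\<close>, \<open>Sbar n\<close> in type \<open>D1\<close>.\<close>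

definition classes_of_size :: "affine_type \<Rightarrow> nat \<Rightarrow> nat \<Rightarrow> label set" where
  "classes_of_size T n v =
    (let m = (if bottom_00 T then 1 else 0);
         k = (if T = D2 then 3 else if T = D1 then 0 else if T = A2_odd then 1 else 2)
     in if v = 1 then (if bottom_00 T then {Star} else {S 1, Sbar 1})
        else if v \<le> n + m then (if T = D1 \<and> v = n then {S n, Sbar n} else {S (v - m)})
        else if (T = D2 \<or> T = B1) \<and> v = n + 1 + m then {S0}
        else {Sbar (2 * n + k - v)})"

lemma mem_classes_of_size:
  assumes "admissible T n" and "c \<in> set (classes T n)"
  shows "c \<in> classes_of_size T n (class_size T n c)"
  using classes_cases[OF assms]
proof (elim disjE exE conjE)
  fix i assume "c = Sbar i" "1 \<le> i" "i \<le> n"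
  then show ?thesis
    using assms(1) by (cases T; cases "i = 1"; cases "i = n") (auto simp: classes_of_size_def bottom_00_def)
next
  fix i assume "c = S i" "1 \<le> i" "i \<le> n"
  then show ?thesis
    using assms(1) by (cases T) (simp_all add: classes_of_size_def bottom_00_def)
qed (use assms(1) in \<open>(cases T; simp add: classes_of_size_def bottom_00_def)+\<close>)

text \<open>Equal slices have equally many blocks, which leaves only the two ambiguous pairs of
  \<open>classes_of_size\<close>; there the half-filled top layers differ.\<close>

lemma inj_on_slice_of:
  assumes "admissible T n"
  shows "inj_on (slice_of T n) (set (classes T n))"
proof (rule inj_onI)
  fix c c' assume cc: "c \<in> set (classes T n)" "c' \<in> set (classes T n)"
    and eq: "slice_of T n c = slice_of T n c'"
  have "class_size T n c = class_size T n c'"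
    using num_blocks_slice_of[OF assms] cc eq by metis
  then have "c \<in> classes_of_size T n (class_size T n c)" "c' \<in> classes_of_size T n (class_size T n c)"
    using mem_classes_of_size[OF assms] cc by metis+
  moreover have "slice_of T n (S 1) \<noteq> slice_of T n (Sbar 1)" if "\<not> bottom_00 T"
    using that assms by (simp add: slice_of_def)
  moreover have "slice_of T n (S n) \<noteq> slice_of T n (Sbar n)" if "T = D1"
    using that assms by (simp add: slice_of_def bottom_00_def)
  ultimately show "c = c'"
    using eq by (auto simp: classes_of_size_def Let_def split: if_splits)
qed

section \<open>Columns as multisets of classes\<close>

definition class_mset :: "affine_type \<Rightarrow> nat \<Rightarrow> nat \<Rightarrow> vector \<Rightarrow> label multiset" where
  "class_mset T n l b =
    mset (concat (map (\<lambda>c. replicate (multiplicity_of T n l b c) c) (classes T n)))"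

lemma mset_column_of: "mset (column_of T n l b) = image_mset (slice_of T n) (class_mset T n l b)"
  unfolding column_of_def class_mset_def mset_map[symmetric] map_concat by (simp add: comp_def)

lemma count_concat_replicate:
  assumes "distinct cs"
  shows "count (mset (concat (map (\<lambda>c. replicate (m c) c) cs))) d = (if d \<in> set cs then m d else 0)"
  using assms by (induction cs) auto

lemma count_class_mset:
  assumes "admissible T n"
  shows "count (class_mset T n l b) c = (if c \<in> set (classes T n) then multiplicity_of T n l b c else 0)"
  unfolding class_mset_def by (rule count_concat_replicate[OF distinct_classes[OF assms]])

lemma set_class_mset:
  assumes "admissible T n"
  shows "set_mset (class_mset T n l b) \<subseteq> set (classes T n)"
  using count_class_mset[OF assms] by (metis count_eq_zero_iff subsetI)

lemma count_image_mset_inj_on: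
  assumes "inj_on f A" and "set_mset M \<subseteq> A" and "x \<in> A"
  shows "count (image_mset f M) (f x) = count M x"
  using assms by (induction M) (auto dest: inj_onD)

text \<open>\<open>counts\<close> counts slices, not labels; the two agree because no two classes
  share a slice.\<close>

lemma counts_column_of:
  assumes "admissible T n" and "c \<in> set (classes T n)"
  shows "counts T n (column_of T n l b) c = int (multiplicity_of T n l b c)"
  using count_image_mset_inj_on[OF inj_on_slice_of[OF assms(1)] set_class_mset[OF assms(1)] assms(2), of l b]
  by (simp add: counts_def count_class_mset assms flip: mset_column_of count_mset)

text \<open>Treats \<open>l'\<close> as the coordinate of the class \<open>Star\<close>.\<close>

definition entry :: "affine_type \<Rightarrow> nat \<Rightarrow> nat \<Rightarrow> vector \<Rightarrow> label \<Rightarrow> int" where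
  "entry T n l b c = (if c = Star then l_prime T n l b else b c)"

lemma entry_simps [simp]:
  "entry T n l b (S i) = b (S i)" "entry T n l b (Sbar i) = b (Sbar i)" "entry T n l b S0 = b S0"
  by (auto simp: entry_def)

lemma multiplicity_of_entry: "multiplicity_of T n l b c = nat (entry T n l b c)"
  by (simp add: multiplicity_of_def entry_def)

text \<open>One criterion for all six types. An upper bound on the total becomes nonnegativity of
  the \<open>Star\<close> entry, an exact total becomes \<open>l' = 0\<close>, and the parity in
  type \<open>C1\<close> passes to \<open>l'\<close> because the width \<open>2 * l\<close> is
  even.\<close>

lemma perfect_set_iff:
  "b \<in> perfect_set T n l \<longleftrightarrow>
     (\<forall>c. entry T n l b c \<ge> 0) \<and> (\<forall>c. c \<notin> coordinates T n \<longrightarrow> b c = 0) \<and>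
     (\<not> bottom_00 T \<longrightarrow> l_prime T n l b = 0) \<and>
     (T = D2 \<or> T = B1 \<longrightarrow> b S0 \<le> 1) \<and> (T = C1 \<longrightarrow> even (l_prime T n l b)) \<and>
     (T = D1 \<longrightarrow> b (S n) = 0 \<or> b (Sbar n) = 0)"
proof -
  have "(\<forall>c. entry T n l b c \<ge> 0) \<longleftrightarrow> l_prime T n l b \<ge> 0 \<and> (\<forall>c. c \<noteq> Star \<longrightarrow> b c \<ge> 0)"
    by (auto simp: entry_def)
  moreover have "(\<forall>c. c \<notin> coordinates T n \<longrightarrow> b c = 0) \<Longrightarrow>
      (\<forall>c. c \<noteq> Star \<longrightarrow> b c \<ge> 0) \<longleftrightarrow> (\<forall>c. b c \<ge> 0)"
    using Star_not_coordinate by (metis order_refl)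
  moreover have "(\<forall>c. b c \<ge> 0) \<Longrightarrow> b S0 \<in> {0, 1} \<longleftrightarrow> b S0 \<le> 1"
    by (smt (verit) insert_iff singletonD)
  ultimately show ?thesis
    unfolding perfect_set_def by (cases T) (auto simp: l_prime_def width_def bottom_00_def)
qed

lemma counts_column_of_entry:
  assumes "admissible T n" and "b \<in> perfect_set T n l" and "c \<in> set (classes T n)"
  shows "counts T n (column_of T n l b) c = entry T n l b c"
  using assms by (simp add: counts_column_of multiplicity_of_entry perfect_set_iff)

text \<open>This is the witness for \<Phi>. The restriction to coordinates matters: at
  \<open>Star\<close> the count is \<open>l'\<close>, while a label that is no class may name the
  slice of another class.\<close>

definition vector_of :: "affine_type \<Rightarrow> nat \<Rightarrow> column \<Rightarrow> vector" where
  "vector_of T n C c = (if c \<in> coordinates T n then counts T n C c else 0)"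

lemma vector_of_column_of:
  assumes "admissible T n" and "b \<in> perfect_set T n l"
  shows "vector_of T n (column_of T n l b) = b"
proof
  fix c
  show "vector_of T n (column_of T n l b) c = b c"
  proof (cases "c \<in> coordinates T n")
    case True
    then have "c \<in> set (classes T n)" "c \<noteq> Star"
      using assms set_classes by (auto intro: ccontr)
    then show ?thesis
      using True assms by (simp add: vector_of_def counts_column_of_entry entry_def)
  qed (use assms in \<open>simp add: vector_of_def perfect_set_def\<close>)
qed

lemma inj_on_column_of: "admissible T n \<Longrightarrow> inj_on (column_of T n l) (perfect_set T n l)"
  by (metis inj_on_inverseI vector_of_column_of)

text \<open>Uniqueness for the description: the multiset of slices fixes \<open>counts\<close>,
  hence \<open>vector_of\<close>, hence the vector behind the column.\<close>

lemma rearrange_eqI: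
  assumes "admissible T n" and "b \<in> perfect_set T n l" and "mset D = mset (column_of T n l b)"
  shows "rearrange T n l D = column_of T n l b"
  unfolding rearrange_def
proof (rule the_equality)
  show "column_of T n l b \<in> column_set T n l \<and> mset (column_of T n l b) = mset D"
    using assms by (simp add: column_set_def)
next
  fix C assume "C \<in> column_set T n l \<and> mset C = mset D"
  then obtain a where a: "a \<in> perfect_set T n l" "C = column_of T n l a" "mset C = mset D"
    by (auto simp: column_set_def)
  then have "counts T n C = counts T n (column_of T n l b)"
    using assms(3) by (simp add: counts_def fun_eq_iff flip: count_mset)
  then have "vector_of T n C = vector_of T n (column_of T n l b)"
    by (simp add: vector_of_def fun_eq_iff)
  then show "C = column_of T n l b"
    using a assms by (simp add: vector_of_column_of)
qed

section \<open>Moving slices between classes\<close>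

text \<open>The value at \<open>Star\<close> is left alone because \<open>l'\<close> is derived from
  the total: changing the other coordinate already changes \<open>l'\<close> by the opposite
  amount.\<close>

definition transfer :: "nat \<Rightarrow> label \<Rightarrow> label \<Rightarrow> vector \<Rightarrow> vector" where
  "transfer k c c' b d =
    (if d = Star then b d else b d - of_bool (d = c) * int k + of_bool (d = c') * int k)"

lemma inj_transfer: "inj (transfer k c c')"
  by (rule injI) (auto simp: transfer_def fun_eq_iff split: if_splits)

lemma sum_of_bool_eq:
  "finite A \<Longrightarrow> (\<Sum>d\<in>A. of_bool (d = c) * (k::int)) = of_bool (c \<in> A) * k"
  by (simp add: of_bool_def if_distrib[of "\<lambda>x. x * k"] cong: if_cong)

text \<open>The point is the case \<open>d = Star\<close>: each of \<open>c\<close>,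
  \<open>c'\<close> that is a coordinate shifts the total. If both are, the shifts cancel; if one is
  \<open>Star\<close>, the remaining shift appears in \<open>l'\<close> with opposite sign.\<close>

lemma entry_transfer:
  assumes "admissible T n" and "c \<in> set (classes T n)" and "c' \<in> set (classes T n)"
  shows "entry T n l (transfer k c c' b) d =
    entry T n l b d - of_bool (d = c) * int k + of_bool (d = c') * int k"
proof (cases "d = Star")
  case True
  have fin: "finite (coordinates T n)" by (simp add: coordinates_def)
  have "total T n (transfer k c c' b) = (\<Sum>d\<in>coordinates T n.
      b d - of_bool (d = c) * int k + of_bool (d = c') * int k)"
    unfolding total_def by (rule sum.cong) (auto simp: transfer_def)
  also have "\<dots> = total T n b - of_bool (c \<in> coordinates T n) * int k
      + of_bool (c' \<in> coordinates T n) * int k"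
    by (simp only: sum.distrib sum_subtractf sum_of_bool_eq[OF fin] total_def)
  finally show ?thesis
    using True assms by (auto simp: entry_def l_prime_def set_classes split: if_splits)
next
  case False
  then show ?thesis by (simp add: entry_def transfer_def)
qed

text \<open>Stated with summands on both sides to avoid truncated subtraction of multisets. The
  bound on \<open>k\<close> keeps the source entry nonnegative, so that \<open>nat\<close> in
  \<open>multiplicity_of\<close> loses nothing.\<close>

lemma class_mset_transfer:
  assumes "admissible T n" and "c \<in> set (classes T n)" and "c' \<in> set (classes T n)"
    and "b \<in> perfect_set T n l" and "int k \<le> entry T n l b c" and "c \<noteq> c'"
  shows "replicate_mset k c + class_mset T n l (transfer k c c' b)
    = replicate_mset k c' + class_mset T n l b"
proof (rule multiset_eqI)
  fix d
  have "0 \<le> entry T n l b d" using assms(4) by (simp add: perfect_set_iff)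
  then show "count (replicate_mset k c + class_mset T n l (transfer k c c' b)) d
      = count (replicate_mset k c' + class_mset T n l b) d"
    using assms by (auto simp: count_class_mset multiplicity_of_entry entry_transfer)
qed

text \<open>The side conditions protect every constraint other than nonnegativity of the source: a
  unit enters \<open>S0\<close> only when it is empty, \<open>l'\<close> changes by an even number
  in type \<open>C1\<close>, and in type \<open>D1\<close> neither \<open>S n\<close> nor
  \<open>Sbar n\<close> is filled while the other is occupied.\<close>

lemma transfer_in_perfect_set_iff:
  assumes "admissible T n" and "c \<in> set (classes T n)" and "c' \<in> set (classes T n)"
    and "b \<in> perfect_set T n l" and "c \<noteq> c'"
    and "c' = S0 \<Longrightarrow> k = 1 \<and> b S0 = 0"
    and "T = C1 \<Longrightarrow> c = Star \<or> c' = Star \<Longrightarrow> even k"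
    and "T = D1 \<Longrightarrow> c' = S n \<Longrightarrow> b (Sbar n) = 0"
    and "T = D1 \<Longrightarrow> c' = Sbar n \<Longrightarrow> b (S n) = 0"
  shows "transfer k c c' b \<in> perfect_set T n l \<longleftrightarrow> int k \<le> entry T n l b c"
proof
  assume "transfer k c c' b \<in> perfect_set T n l"
  then have "entry T n l (transfer k c c' b) c \<ge> 0" by (simp add: perfect_set_iff)
  then show "int k \<le> entry T n l b c" using assms by (simp add: entry_transfer)
next
  let ?b = "transfer k c c' b"
  assume k: "int k \<le> entry T n l b c"
  note b = assms(4)[unfolded perfect_set_iff]
  note e = entry_transfer[OF assms(1-3), of l k b]
  have lp: "l_prime T n l ?b = l_prime T n l b - of_bool (Star = c) * int k + of_bool (Star = c') * int k"
    using e[of Star] by (simp add: entry_def)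
  have e': "?b d = b d - of_bool (d = c) * int k + of_bool (d = c') * int k" if "d \<noteq> Star" for d
    using that by (simp add: transfer_def)
  have "entry T n l ?b d \<ge> 0" for d
    using b k by (simp add: e)
  moreover have "?b d = 0" if "d \<notin> coordinates T n" for d
    using that b assms(1-3) by (auto simp: transfer_def set_classes split: if_splits)
  moreover have "l_prime T n l ?b = 0" if "\<not> bottom_00 T"
    using that b assms(1-3) unfolding lp by (auto simp: of_bool_def)
  moreover have "?b S0 \<le> 1" if "T = D2 \<or> T = B1"
    using that b assms(6) by (auto simp: e')
  moreover have "even (l_prime T n l ?b)" if "T = C1"
    using that b assms(7) unfolding lp by (simp add: of_bool_def)
  moreover have "?b (S n) = 0 \<or> ?b (Sbar n) = 0" if "T = D1"
  proof -
    have "b (S n) \<ge> 0" "b (Sbar n) \<ge> 0" "b (S n) = 0 \<or> b (Sbar n) = 0"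
      using assms(4) that by (auto simp: perfect_set_def)
    then show ?thesis
      using that k assms(5,8,9) by (auto simp: e')
  qed
  ultimately show "?b \<in> perfect_set T n l"
    unfolding perfect_set_iff by blast
qed

section \<open>Adding a block to a slice\<close>

lemma not_half_filled_self: "L \<notin> half_filled L"
  by (cases L rule: half_filled.cases) auto

lemma pattern_less: "k < length (delta_slice T n) \<Longrightarrow> pattern T n k = delta_slice T n ! k"
  by (simp add: pattern_def)

text \<open>The bound on \<open>k\<close> is not strict: for a full \<delta>-slice the periodic
  pattern starts again, which is the case where a \<delta>-slice is removed afterwards.\<close>

lemma add_block_complete:
  assumes "k \<le> length (delta_slice T n)" and "start_layer (pattern T n k) i = Some L"
  shows "add_block T n i (take k (delta_slice T n)) = Some (take k (delta_slice T n) @ [L])"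
proof -
  let ?s = "take k (delta_slice T n)"
  have "last ?s \<notin> half_filled (pattern T n (length ?s - 1))" if "?s \<noteq> []"
  proof -
    have "last ?s = pattern T n (length ?s - 1)"
      using that assms(1) by (subst last_conv_nth) (auto simp: pattern_less)
    then show ?thesis using not_half_filled_self by metis
  qed
  then show ?thesis
    using assms by (auto simp: add_block_def Let_def min_def)
qed

lemma add_block_half:
  assumes "k < length (delta_slice T n)" and "L \<in> half_filled (delta_slice T n ! k)"
    and "fill_layer (delta_slice T n ! k) i L = Some L'"
  shows "add_block T n i (take k (delta_slice T n) @ [L]) = Some (take k (delta_slice T n) @ [L'])"
  using assms by (simp add: add_block_def pattern_less min_def)

lemma delta_slice_ne_Nil [simp]: "delta_slice T n \<noteq> []"
  by (cases T) simp_all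

text \<open>A full \<delta>-slice with nothing on top stays, because \<open>length s - 1\<close> is
  then still below the divisor.\<close>

lemma remove_delta_short:
  assumes "length s \<le> length (delta_slice T n)"
  shows "remove_delta T n s = s"
proof -
  have "(length s - 1) div length (delta_slice T n) = 0"
    using assms delta_slice_ne_Nil[of T n] by (intro div_less) (cases s; simp)
  then show ?thesis by (simp add: remove_delta_def)
qed

lemma remove_delta_wrap: "remove_delta T n (delta_slice T n @ [L]) = [L]"
  by (simp add: remove_delta_def)

lemma remove_delta_slice_of:
  "admissible T n \<Longrightarrow> c \<in> set (classes T n) \<Longrightarrow> remove_delta T n (slice_of T n c) = slice_of T n c"
  using stacked_slice_of by (intro remove_delta_short) auto

text \<open>Isolates the effect of a block on one slice from the choice of the class, which depends
  on the whole column. The rules that follow distinguish how the block lands: opening a layer, being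
  a whole layer, completing a half-filled layer, or opening a new period above a full
  \<delta>-slice.\<close>

definition block_move :: "affine_type \<Rightarrow> nat \<Rightarrow> nat \<Rightarrow> label \<Rightarrow> label \<Rightarrow> bool" where
  "block_move T n i c c' \<longleftrightarrow>
     (\<exists>s. add_block T n i (slice_of T n c) = Some s \<and> remove_delta T n s = slice_of T n c')"

lemma block_move_start:
  assumes "k < length (delta_slice T n)" and "slice_of T n c = take k (delta_slice T n)"
    and "start_layer (delta_slice T n ! k) i = Some L"
    and "slice_of T n c' = take k (delta_slice T n) @ [L]"
  shows "block_move T n i c c'"
  using assms add_block_complete[of k T n i L]
  by (auto simp: block_move_def pattern_less intro!: remove_delta_short)

lemma block_move_Whole:
  assumes "k < length (delta_slice T n)" and "slice_of T n c = take k (delta_slice T n)"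
    and "delta_slice T n ! k = Whole i" and "slice_of T n c' = take (Suc k) (delta_slice T n)"
  shows "block_move T n i c c'"
  using assms by (intro block_move_start[of k]) (auto simp: take_Suc_conv_app_nth)

lemma block_move_fill:
  assumes "k < length (delta_slice T n)" and "slice_of T n c = take k (delta_slice T n) @ [L]"
    and "L \<in> half_filled (delta_slice T n ! k)"
    and "fill_layer (delta_slice T n ! k) i L = Some (delta_slice T n ! k)"
    and "slice_of T n c' = take (Suc k) (delta_slice T n)"
  shows "block_move T n i c c'"
  using assms add_block_half[of k T n L i "delta_slice T n ! k"]
  by (auto simp: block_move_def take_Suc_conv_app_nth intro!: remove_delta_short)

lemma block_move_wrap:
  assumes "slice_of T n c = delta_slice T n"
    and "start_layer (delta_slice T n ! 0) i = Some L" and "slice_of T n c' = [L]"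
  shows "block_move T n i c c'"
  using assms add_block_complete[of "length (delta_slice T n)" T n i L]
  by (simp add: block_move_def remove_delta_wrap pattern_def)

section \<open>Positions of the layers in a \<delta>-slice\<close>

lemma delta_ascending:
  assumes "admissible T n" and "generic_index T n i"
  shows "delta_slice T n ! (if bottom_00 T then i else i - 1) = Whole i"
  using assms by (cases T) (auto simp: bottom_00_def nth_append nth_Cons')

text \<open>The descending part ends with colour 1 over (0,0) and with colour 2 over (0,1), so
  counting from the top the offset is \<open>i\<close> or \<open>i - 1\<close>. The same shift by
  one occurs in the ascending part, since the bottom layer (0,1) uses up two colours.\<close>

lemma delta_descending:
  assumes "admissible T n" and "generic_index T n i"
  shows "delta_slice T n ! (length (delta_slice T n) - (if bottom_00 T then i else i - 1)) = Whole i"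
  using assms by (cases T) (auto simp: bottom_00_def nth_append nth_Cons' rev_nth)

text \<open>Height of the layer containing colour \<open>n\<close>, where the pattern turns. In type
  \<open>D1\<close> this layer also takes colour \<open>n - 1\<close> and therefore lies one step
  lower.\<close>

definition peak :: "affine_type \<Rightarrow> nat \<Rightarrow> nat" where
  "peak T n = (if bottom_00 T then n else if T = D1 then n - 2 else n - 1)"

lemma delta_peak:
  "admissible T n \<Longrightarrow> delta_slice T n ! peak T n =
    (if T = D1 then two (n - 1) n else if T = D2 \<or> T = B1 then two n n else Whole n)"
  by (cases T) (auto simp: peak_def bottom_00_def nth_append nth_Cons')

lemma peak_less: "admissible T n \<Longrightarrow> peak T n < length (delta_slice T n)"
  by (cases T) (auto simp: peak_def bottom_00_def)

lemma take_peak: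
  "admissible T n \<Longrightarrow> take (peak T n) (delta_slice T n) =
    (if bottom_00 T then two 0 0 # map Whole [1..<n]
     else two 0 1 # map Whole [2..<(if T = D1 then n - 1 else n)])"
  by (cases T) (auto simp: peak_def bottom_00_def take_Cons')

lemma delta_bottom:
  "delta_slice T n ! 0 = (if bottom_00 T then two 0 0 else two 0 1)"
  by (cases T) (auto simp: bottom_00_def)

lemma generic_bounds:
  assumes "admissible T n" and "generic_index T n i"
  shows "1 \<le> i" "i < n" "\<not> bottom_00 T \<Longrightarrow> 2 \<le> i" "T = D1 \<Longrightarrow> i + 2 \<le> n"
  using assms by (cases T; simp add: bottom_00_def)+

lemma slice_of_Sbar:
  assumes "admissible T n" and "1 \<le> i" and "\<not> bottom_00 T \<Longrightarrow> 2 \<le> i" and "T = D1 \<Longrightarrow> i < n"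
  shows "slice_of T n (Sbar i) =
    take (length (delta_slice T n) - (if bottom_00 T then i - 1 else i - 2)) (delta_slice T n)"
  using assms by (auto simp: slice_of_def Let_def)

lemma slice_of_S:
  assumes "admissible T n" and "1 \<le> i" and "i \<le> n" and "\<not> bottom_00 T \<Longrightarrow> 2 \<le> i" and "T = D1 \<Longrightarrow> i < n"
  shows "slice_of T n (S i) = take (if bottom_00 T then i else i - 1) (delta_slice T n)"
  using assms slice_of_00 slice_of_01 by simp

lemma block_move_ascending:
  assumes "admissible T n" and "generic_index T n i"
  shows "block_move T n i (S i) (S (i + 1))"
proof (rule block_move_Whole)
  note b = generic_bounds[OF assms]
  let ?k = "if bottom_00 T then i else i - 1"
  show "?k < length (delta_slice T n)"
    using b assms(1) by (auto simp: length_delta)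
  show "delta_slice T n ! ?k = Whole i" by (rule delta_ascending[OF assms])
  show "slice_of T n (S i) = take ?k (delta_slice T n)"
    using b assms(1) by (intro slice_of_S) auto
  have "Suc ?k = (if bottom_00 T then i + 1 else i + 1 - 1)" using b by simp
  then show "slice_of T n (S (i + 1)) = take (Suc ?k) (delta_slice T n)"
    using b assms(1) by (subst slice_of_S) auto
qed

text \<open>\<open>Sbar (i + 1)\<close> ends right below the descending \<open>i\<close>-layer,
  which the new block fills completely.\<close>

lemma block_move_descending:
  assumes "admissible T n" and "generic_index T n i"
  shows "block_move T n i (Sbar (i + 1)) (Sbar i)"
proof (rule block_move_Whole)
  note b = generic_bounds[OF assms]
  let ?k = "length (delta_slice T n) - (if bottom_00 T then i else i - 1)"
  show "?k < length (delta_slice T n)"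
    using b assms(1) by (auto simp: length_delta)
  show "delta_slice T n ! ?k = Whole i" by (rule delta_descending[OF assms])
  show "slice_of T n (Sbar (i + 1)) = take ?k (delta_slice T n)"
    using b assms(1) by (subst slice_of_Sbar) auto
  have "Suc ?k = length (delta_slice T n) - (if bottom_00 T then i - 1 else i - 2)"
    using b assms(1) by (auto simp: length_delta)
  then show "slice_of T n (Sbar i) = take (Suc ?k) (delta_slice T n)"
    using b assms(1) by (subst slice_of_Sbar) auto
qed

section \<open>Moves at the bottom layer\<close>

lemma slice_of_bottom_00:
  assumes "admissible T n" and "bottom_00 T"
  shows "slice_of T n Star = [Halves None (Some 0)]" "slice_of T n (S 1) = [two 0 0]"
    "slice_of T n (Sbar 1) = delta_slice T n"
  using assms by (auto simp: slice_of_def)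

lemma slice_of_bottom_01:
  assumes "admissible T n" and "\<not> bottom_00 T"
  shows "slice_of T n (S 1) = [Halves (Some 0) None]" "slice_of T n (Sbar 1) = [Halves None (Some 1)]"
    "slice_of T n (S 2) = [two 0 1]" "slice_of T n (Sbar 2) = delta_slice T n"
  using assms by (cases T; simp add: slice_of_def bottom_00_def)+

lemma take_1_delta: "take (Suc 0) (delta_slice T n) = [if bottom_00 T then two 0 0 else two 0 1]"
  by (cases T) (auto simp: bottom_00_def)

text \<open>The back half is placed first: \<open>Star\<close> is completed by the front half, and a
  block above the full slice \<open>Sbar 1\<close> survives as \<open>Star\<close> once the
  \<delta>-slice is gone.\<close>

lemma block_moves_bottom_00:
  assumes "admissible T n" and "bottom_00 T"
  shows "block_move T n 0 Star (S 1)" "block_move T n 0 (Sbar 1) Star"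
proof -
  note s = slice_of_bottom_00[OF assms]
  show "block_move T n 0 Star (S 1)"
    by (rule block_move_fill[of 0 _ _ _ "Halves None (Some 0)"])
      (use assms s in \<open>simp_all add: delta_bottom take_1_delta\<close>)
  show "block_move T n 0 (Sbar 1) Star"
    by (rule block_move_wrap) (use assms s in \<open>simp_all add: delta_bottom\<close>)
qed

text \<open>Serves type \<open>C1\<close> when both half-depth blocks go onto one slice. The
  \<delta>-slice is removed only after the second block, so this is not literally a composition of
  two instances of \<open>block_move\<close>.\<close>

lemma double_block_move:
  assumes "admissible T n" and "bottom_00 T"
  obtains s where "Option.bind (add_block T n 0 (slice_of T n (Sbar 1))) (add_block T n 0) = Some s"
    and "remove_delta T n s = slice_of T n (S 1)"
proof -
  let ?d = "delta_slice T n"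
  have 1: "add_block T n 0 ?d = Some (?d @ [Halves None (Some 0)])"
    using add_block_complete[of "length ?d" T n 0] assms by (simp add: pattern_def delta_bottom)
  have 2: "add_block T n 0 (?d @ [Halves None (Some 0)]) = Some (?d @ [two 0 0])"
    using assms by (simp add: add_block_def pattern_def delta_bottom)
  show ?thesis
    using 1 2 slice_of_bottom_00[OF assms] by (intro that[of "?d @ [two 0 0]"]) (simp_all add: remove_delta_wrap)
qed

text \<open>\<open>S 1\<close> holds the 0-block and lacks the 1-block, while \<open>Sbar 1\<close>
  is the reverse; above the full slice \<open>Sbar 2\<close> either half may come first.\<close>

lemma block_moves_bottom_01:
  assumes "admissible T n" and "\<not> bottom_00 T"
  shows "block_move T n 0 (Sbar 1) (S 2)" "block_move T n 0 (Sbar 2) (S 1)"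
    "block_move T n 1 (S 1) (S 2)" "block_move T n 1 (Sbar 2) (Sbar 1)"
proof -
  note s = slice_of_bottom_01[OF assms]
  show "block_move T n 0 (Sbar 1) (S 2)"
    by (rule block_move_fill[of 0 _ _ _ "Halves None (Some 1)"])
      (use assms s in \<open>simp_all add: delta_bottom take_1_delta\<close>)
  show "block_move T n 1 (S 1) (S 2)"
    by (rule block_move_fill[of 0 _ _ _ "Halves (Some 0) None"])
      (use assms s in \<open>simp_all add: delta_bottom take_1_delta\<close>)
  show "block_move T n 0 (Sbar 2) (S 1)" "block_move T n 1 (Sbar 2) (Sbar 1)"
    by (rule block_move_wrap; use assms s in \<open>simp add: delta_bottom\<close>)+
qed

section \<open>Moves at the peak\<close>

lemma slice_of_below_peak:
  assumes "admissible T n"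
  shows "slice_of T n (S (if T = D1 then n - 1 else n)) = take (peak T n) (delta_slice T n)"
  using assms by (cases T; subst slice_of_S) (auto simp: peak_def bottom_00_def numeral_2_eq_2)

text \<open>In type \<open>D1\<close> the labels \<open>S n\<close> and \<open>Sbar n\<close> are
  the two half-filled states of the peak layer itself, so the complete slices ending next to it
  carry the index \<open>n - 1\<close>.\<close>

lemma slice_of_above_peak:
  assumes "admissible T n"
  shows "slice_of T n (Sbar (if T = D1 then n - 1 else n)) = take (Suc (peak T n)) (delta_slice T n)"
proof -
  have "Suc (peak T n) = length (delta_slice T n) -
      (if bottom_00 T then (if T = D1 then n - 1 else n) - 1 else (if T = D1 then n - 1 else n) - 2)"
    using assms by (cases T) (auto simp: peak_def bottom_00_def)
  then show ?thesis
    using assms by (cases T; subst slice_of_Sbar) (auto simp: bottom_00_def)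
qed

lemma block_move_peak_Whole:
  assumes "admissible T n" and "T \<notin> {D2, B1, D1}"
  shows "block_move T n n (S n) (Sbar n)"
  by (rule block_move_Whole[of "peak T n"])
    (use assms slice_of_below_peak[OF assms(1)] slice_of_above_peak[OF assms(1)]
      in \<open>auto simp: delta_peak peak_less\<close>)

lemma block_moves_peak_nn:
  assumes "admissible T n" and "T = D2 \<or> T = B1"
  shows "block_move T n n (S n) S0" "block_move T n n S0 (Sbar n)"
proof -
  have S0: "slice_of T n S0 = take (peak T n) (delta_slice T n) @ [Halves None (Some n)]"
    using assms by (auto simp: take_peak slice_of_def bottom_00_def)
  show "block_move T n n (S n) S0"
    by (rule block_move_start[of "peak T n"])
      (use assms slice_of_below_peak[OF assms(1)] S0 in \<open>auto simp: delta_peak peak_less\<close>)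
  show "block_move T n n S0 (Sbar n)"
    by (rule block_move_fill[of "peak T n"])
      (use assms slice_of_above_peak[OF assms(1)] S0 in \<open>auto simp: delta_peak peak_less\<close>)
qed

text \<open>The four sides of a square from \<open>S (n - 1)\<close> to \<open>Sbar (n - 1)\<close>:
  the halves \<open>n - 1\<close> and \<open>n\<close> may be placed in either order.\<close>

lemma block_moves_peak_D1:
  assumes "admissible D1 n"
  shows "block_move D1 n n (S n) (Sbar (n - 1))" "block_move D1 n n (S (n - 1)) (Sbar n)"
    "block_move D1 n (n - 1) (S (n - 1)) (S n)" "block_move D1 n (n - 1) (Sbar n) (Sbar (n - 1))"
proof -
  have Sn: "slice_of D1 n (S n) = take (peak D1 n) (delta_slice D1 n) @ [Halves (Some (n - 1)) None]"
    "slice_of D1 n (Sbar n) = take (peak D1 n) (delta_slice D1 n) @ [Halves None (Some n)]"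
    using assms unfolding take_peak[OF assms] by (auto simp: slice_of_def bottom_00_def)
  note s = assms Sn slice_of_below_peak[OF assms] slice_of_above_peak[OF assms]
  show "block_move D1 n n (S n) (Sbar (n - 1))"
    by (rule block_move_fill[of "peak D1 n" _ _ _ "Halves (Some (n - 1)) None"];
        use s in \<open>auto simp: delta_peak peak_less simp del: delta_slice.simps\<close>)
  show "block_move D1 n (n - 1) (Sbar n) (Sbar (n - 1))"
    by (rule block_move_fill[of "peak D1 n" _ _ _ "Halves None (Some n)"];
        use s in \<open>auto simp: delta_peak peak_less simp del: delta_slice.simps\<close>)
  show "block_move D1 n n (S (n - 1)) (Sbar n)" "block_move D1 n (n - 1) (S (n - 1)) (S n)"
    by (rule block_move_start[of "peak D1 n"];
        use s in \<open>auto simp: delta_peak peak_less simp del: delta_slice.simps\<close>)+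
qed

section \<open>Kashiwara operators as transfers\<close>

text \<open>Source and target class of the step \<open>f\<^sub>i\<close>, a common reference against
  which \<open>perfect_move\<close> and \<open>add_to_column\<close> are both compared.\<close>

definition arrow :: "affine_type \<Rightarrow> nat \<Rightarrow> nat \<Rightarrow> vector \<Rightarrow> label \<times> label" where
  "arrow T n i b =
    (if generic_index T n i then
       (if b (S (i + 1)) \<ge> b (Sbar (i + 1)) then (S i, S (i + 1)) else (Sbar (i + 1), Sbar i))
     else if i = 0 then
       (if bottom_00 T then
          (if b (S 1) \<ge> b (Sbar 1) then (Star, S 1)
           else if T = C1 \<and> b (S 1) = b (Sbar 1) - 1 then (Sbar 1, S 1)
           else (Sbar 1, Star))
        else (if b (S 2) \<ge> b (Sbar 2) then (Sbar 1, S 2) else (Sbar 2, S 1)))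
     else if i = n then
       (if T = D1 then
          (if b (S n) \<ge> 1 \<and> b (Sbar n) = 0 then (S n, Sbar (n - 1)) else (S (n - 1), Sbar n))
        else if T = D2 \<or> T = B1 then (if b S0 = 0 then (S n, S0) else (S0, Sbar n))
        else (S n, Sbar n))
     else if i = 1 then (if b (S 2) \<ge> b (Sbar 2) then (S 1, S 2) else (Sbar 2, Sbar 1))
     else (if b (Sbar n) = 0 then (S (n - 1), S n) else (Sbar n, Sbar (n - 1))))"

text \<open>Number of slices that change class. In type \<open>C1\<close> with \<open>i = 0\<close>
  two half-depth blocks are added, normally on two slices; in the middle branch both land on one
  slice.\<close>

definition amount :: "affine_type \<Rightarrow> nat \<Rightarrow> vector \<Rightarrow> nat" where
  "amount T i b = (if T = C1 \<and> i = 0 \<and> b (S 1) \<noteq> b (Sbar 1) - 1 then 2 else 1)"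

text \<open>Each case records the inequalities on \<open>i\<close> and \<open>n\<close> that resolve
  the nested conditionals of the definitions by simplification.\<close>

lemma index_cases:
  assumes "admissible T n" and "i \<le> n"
  obtains (generic) "generic_index T n i" "1 \<le> i" "i < n" "\<not> bottom_00 T \<Longrightarrow> 2 \<le> i" "T = D1 \<Longrightarrow> i + 2 \<le> n"
  | (bottom_00) "\<not> generic_index T n i" "i = 0" "bottom_00 T" "1 \<le> n"
  | (bottom_01) "\<not> generic_index T n i" "i = 0 \<or> i = 1" "\<not> bottom_00 T" "3 \<le> n" "n \<noteq> 0" "n \<noteq> 1"
      "T \<noteq> C1" "T = D1 \<Longrightarrow> 4 \<le> n"
  | (last) "\<not> generic_index T n i" "i = n" "1 \<le> n" "n \<noteq> 0" "T = D1 \<Longrightarrow> 4 \<le> n"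
  | (next_to_last) "\<not> generic_index T n i" "T = D1" "i = n - 1" "i \<noteq> 0" "i \<noteq> 1" "i \<noteq> n" "4 \<le> n"
proof -
  have "generic_index T n i \<or> i = 0 \<or> i = 1 \<and> \<not> bottom_00 T \<or> i = n \<or> T = D1 \<and> i = n - 1"
    using assms by (cases T) (auto simp: bottom_00_def)
  moreover have "\<not> generic_index T n i" if "i = 0 \<or> i = n \<or> T = D1 \<and> i = n - 1 \<or> i = 1 \<and> \<not> bottom_00 T"
    using that assms(1) by (cases T) (auto simp: bottom_00_def)
  moreover have n: "1 \<le> n" "T = D1 \<Longrightarrow> 4 \<le> n" "\<not> bottom_00 T \<Longrightarrow> 3 \<le> n"
    using assms(1) by (cases T; simp add: bottom_00_def)+
  ultimately consider "generic_index T n i" | "\<not> generic_index T n i" "i = 0" "bottom_00 T"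
    | "\<not> generic_index T n i" "i = 0 \<or> i = 1" "\<not> bottom_00 T" | "\<not> generic_index T n i" "i = n"
    | "\<not> generic_index T n i" "T = D1" "i = n - 1"
    by metis
  then show thesis
  proof cases
    case 1
    then show ?thesis using generic_bounds[OF assms(1), of i] by (intro generic)
  next
    case 2
    then show ?thesis using n by (intro bottom_00)
  next
    case 3
    then have "T \<noteq> C1" "n \<noteq> 0" "n \<noteq> 1" using n by (auto simp: bottom_00_def)
    then show ?thesis using 3 n by (intro bottom_01)
  next
    case 4
    then show ?thesis using n by (intro last) simp_all
  next
    case 5
    then have "i \<noteq> 0" "i \<noteq> 1" "i \<noteq> n" using n by simp_all
    then show ?thesis using 5 n by (intro next_to_last)
  qed
qed

lemma C1_D1_simps [simp]: "bottom_00 C1" "\<not> bottom_00 D1"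
  by (simp_all add: bottom_00_def)

lemma perfect_S0: "b \<in> perfect_set T n l \<Longrightarrow> b S0 = 0 \<or> b S0 = 1"
  by (cases T) (auto simp: perfect_set_def coordinates_def)

lemma perfect_nonneg: "b \<in> perfect_set T n l \<Longrightarrow> 0 \<le> b c"
  by (simp add: perfect_set_def)

lemma perfect_D1: "b \<in> perfect_set D1 n l \<Longrightarrow> b (S n) = 0 \<or> b (Sbar n) = 0"
  by (simp add: perfect_set_def)

lemma transfer_eq_upd:
  "c \<noteq> Star \<Longrightarrow> c' \<noteq> Star \<Longrightarrow> c \<noteq> c' \<Longrightarrow> transfer k c c' b = b(c := b c - int k, c' := b c' + int k)"
  "c' \<noteq> Star \<Longrightarrow> transfer k Star c' b = b(c' := b c' + int k)"
  "c \<noteq> Star \<Longrightarrow> transfer k c Star b = b(c := b c - int k)"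
  by (auto simp: transfer_def)

lemma perfect_move_arrow:
  assumes "admissible T n" and "i \<le> n" and "b \<in> perfect_set T n l"
  shows "perfect_move T n i b = transfer (amount T i b) (fst (arrow T n i b)) (snd (arrow T n i b)) b"
proof -
  note S0 = perfect_S0[OF assms(3)]
  note defs = perfect_move_def arrow_def amount_def transfer_eq_upd fun_upd_twist
  from assms(1,2) show ?thesis
  proof (cases rule: index_cases)
    case bottom_01
    from bottom_01(2) show ?thesis
      using bottom_01(1,3-) by (elim disjE) (simp_all add: defs)
  next
    case last
    \<comment> \<open>\<open>perfect_move\<close> assigns 0 or 1 to \<open>S0\<close>, whereas
      \<open>transfer\<close> shifts it by 1; these agree only because \<open>b S0\<close> is 0 or
      1.\<close>
    from S0 show ?thesis
      using last by (elim disjE) (simp_all add: defs)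
  qed (simp_all add: defs)
qed

lemma arrow_classes:
  assumes "admissible T n" and "i \<le> n"
  shows "fst (arrow T n i b) \<in> set (classes T n)" "snd (arrow T n i b) \<in> set (classes T n)"
    "fst (arrow T n i b) \<noteq> snd (arrow T n i b)"
  using assms by (cases rule: index_cases; use assms(1) in \<open>auto simp: arrow_def\<close>)+

text \<open>These are exactly the side conditions of \<open>transfer_in_perfect_set_iff\<close>,
  read off from the branch conditions.\<close>

lemma arrow_admissible:
  assumes "admissible T n" and "i \<le> n" and "b \<in> perfect_set T n l"
  shows "snd (arrow T n i b) = S0 \<Longrightarrow> amount T i b = 1 \<and> b S0 = 0"
    and "T = C1 \<Longrightarrow> fst (arrow T n i b) = Star \<or> snd (arrow T n i b) = Star \<Longrightarrow> even (amount T i b)"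
    and "T = D1 \<Longrightarrow> snd (arrow T n i b) = S n \<Longrightarrow> b (Sbar n) = 0"
    and "T = D1 \<Longrightarrow> snd (arrow T n i b) = Sbar n \<Longrightarrow> b (S n) = 0"
proof -
  show "amount T i b = 1 \<and> b S0 = 0" if "snd (arrow T n i b) = S0"
    using assms(1,2) by (cases rule: index_cases)
      (use that in \<open>auto simp: arrow_def amount_def split: if_splits\<close>)
  show "even (amount T i b)" if "T = C1" "fst (arrow T n i b) = Star \<or> snd (arrow T n i b) = Star"
    using assms(1,2) by (cases rule: index_cases)
      (use that in \<open>auto simp: arrow_def amount_def split: if_splits\<close>)
  show "b (Sbar n) = 0" if "T = D1" "snd (arrow T n i b) = S n"
    using assms(1,2) by (cases rule: index_cases)
      (use that in \<open>auto simp: arrow_def split: if_splits\<close>)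
  show "b (S n) = 0" if "T = D1" "snd (arrow T n i b) = Sbar n"
    using assms(1,2)
  proof (cases rule: index_cases)
    case last
    \<comment> \<open>The branch into \<open>Sbar n\<close> is taken if \<open>b (S n) < 1\<close>
      or \<open>b (Sbar n) \<noteq> 0\<close>; in the second case the \<open>D1\<close> condition
      forces \<open>b (S n) = 0\<close>.\<close>
    then show ?thesis
      using that assms(3) perfect_D1[of b n l] perfect_nonneg[OF assms(3), of "S n"]
      by (auto simp: arrow_def split: if_splits)
  qed (use that in \<open>auto simp: arrow_def split: if_splits\<close>)
qed

lemma perfect_move_in_perfect_set_iff:
  assumes "admissible T n" and "i \<le> n" and "b \<in> perfect_set T n l"
  shows "perfect_move T n i b \<in> perfect_set T n l \<longleftrightarrow>
    int (amount T i b) \<le> entry T n l b (fst (arrow T n i b))"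
  unfolding perfect_move_arrow[OF assms]
  by (rule transfer_in_perfect_set_iff[OF assms(1) arrow_classes(1,2)[OF assms(1,2)] assms(3)
        arrow_classes(3)[OF assms(1,2)]]) (use arrow_admissible[OF assms] in auto)

text \<open>The branch taken by \<open>f\<^sub>i\<close> can be read off its result.\<close>

definition arrow_into :: "affine_type \<Rightarrow> nat \<Rightarrow> nat \<Rightarrow> vector \<Rightarrow> nat \<times> label \<times> label" where
  "arrow_into T n i b =
    (if generic_index T n i then
       (if b (S (i + 1)) > b (Sbar (i + 1)) then (1, S i, S (i + 1)) else (1, Sbar (i + 1), Sbar i))
     else if i = 0 then
       (if bottom_00 T then
          (if T = C1 \<and> b (S 1) = b (Sbar 1) + 1 then (1, Sbar 1, S 1)
           else if b (S 1) > b (Sbar 1) then (if T = C1 then 2 else 1, Star, S 1)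
           else (if T = C1 then 2 else 1, Sbar 1, Star))
        else (if b (S 2) > b (Sbar 2) then (1, Sbar 1, S 2) else (1, Sbar 2, S 1)))
     else if i = n then
       (if T = D1 then
          (if b (Sbar n) = 0 then (1, S n, Sbar (n - 1)) else (1, S (n - 1), Sbar n))
        else if T = D2 \<or> T = B1 then (if b S0 = 1 then (1, S n, S0) else (1, S0, Sbar n))
        else (1, S n, Sbar n))
     else if i = 1 then (if b (S 2) > b (Sbar 2) then (1, S 1, S 2) else (1, Sbar 2, Sbar 1))
     else (if b (S n) \<ge> 1 then (1, S (n - 1), S n) else (1, Sbar n, Sbar (n - 1))))"

text \<open>Where a branch compares \<open>x\<^sub>j\<close> with \<open>\<bar>x\<^sub>j\<close>,
  the move raises the difference \<open>x\<^sub>j - \<bar>x\<^sub>j\<close>: values \<ge> 0 become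
  positive and negative ones stay \<le> 0. In type \<open>C1\<close> with \<open>i = 0\<close> the
  differences \<ge> 0, = -1, \<le> -2 become \<ge> 2, = 1, \<le> 0. At the peak, the occupied
  half-filled class tells the branch.\<close>

lemma arrow_into_perfect_move:
  assumes "admissible T n" and "i \<le> n" and "b \<in> perfect_set T n l"
    and "perfect_move T n i b \<in> perfect_set T n l"
  shows "arrow_into T n i (perfect_move T n i b) = (amount T i b, arrow T n i b)"
proof -
  note nonneg = perfect_nonneg[OF assms(3), of "S n"] perfect_nonneg[OF assms(3), of "Sbar n"]
  note S0 = perfect_S0[OF assms(3)]
  have D1: "b (S n) = 0 \<or> b (Sbar n) = 0" if "T = D1"
    using assms(3) that perfect_D1 by blast
  note defs = perfect_move_def arrow_def amount_def arrow_into_def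
  from assms(1,2) show ?thesis
  proof (cases rule: index_cases)
    case bottom_01
    from bottom_01(2) show ?thesis
      using bottom_01(1,3-) by (elim disjE) (simp_all add: defs)
  next
    case last
    show ?thesis
    proof (cases "T = D1")
      case True
      from D1[OF True] show ?thesis
        using last(1-3) True nonneg by (elim disjE) (simp_all add: defs)
    next
      case False
      from S0 show ?thesis
        using last(1-3) False by (elim disjE) (simp_all add: defs)
    qed
  next
    case next_to_last
    from D1[OF \<open>T = D1\<close>] show ?thesis
      using next_to_last nonneg by (elim disjE) (simp_all add: defs)
  qed (simp_all add: defs)
qed

text \<open>The common result determines \<open>amount\<close> and \<open>arrow\<close> through
  \<open>arrow_into\<close>, and with these fixed the move is a translation.\<close>

lemma perfect_f_inj:
  assumes "admissible T n" and "i \<le> n" and "a \<in> perfect_set T n l" "b \<in> perfect_set T n l"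
    and "perfect_f T n l i a = Some d" and "perfect_f T n l i b = Some d"
  shows "a = b"
proof -
  have d: "perfect_move T n i a = d" "perfect_move T n i b = d" "d \<in> perfect_set T n l"
    using assms(5,6) by (auto simp: perfect_f_def Let_def split: if_splits)
  then have "(amount T i a, arrow T n i a) = (amount T i b, arrow T n i b)"
    using arrow_into_perfect_move[OF assms(1,2)] assms(3,4) by metis
  then show ?thesis
    using d perfect_move_arrow[OF assms(1,2)] assms(3,4) inj_transfer by (metis injD prod.inject)
qed

section \<open>Operators on columns\<close>

lemma rightmost:
  assumes "s \<in> set C"
  shows "rightmost s C < length C \<and> C ! rightmost s C = s"
proof -
  have "rightmost s C \<in> {p. p < length C \<and> C ! p = s}"
    unfolding rightmost_def using assms by (intro Max_in) (auto simp: in_set_conv_nth)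
  then show ?thesis by simp
qed

lemma mset_update_rightmost:
  "s \<in> set C \<Longrightarrow> add_mset s (mset (C[rightmost s C := s'])) = add_mset s' (mset C)"
  using rightmost[of s C] by (auto simp: mset_update)

text \<open>Positions are forgotten because the column is rearranged afterwards. Here
  \<open>s'\<close> is the slice before removal of \<delta>-slices, and the additive form again
  avoids multiset subtraction.\<close>

definition replaces :: "nat \<Rightarrow> slice \<Rightarrow> slice \<Rightarrow> column \<Rightarrow> column option \<Rightarrow> bool" where
  "replaces k s s' C R \<longleftrightarrow>
    (if k \<le> count (mset C) s
     then \<exists>D. R = Some D \<and> replicate_mset k s + mset D = replicate_mset k s' + mset C
     else R = None)"

lemma replaces_add_rightmost:
  assumes "add_block T n i (slice_of T n c) = Some s"
  shows "replaces 1 (slice_of T n c) s C (add_rightmost T n i c C)"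
  using assms by (auto simp: replaces_def add_rightmost_def Let_def mset_update_rightmost Suc_le_eq)

lemma replaces_add2_rightmost:
  assumes "Option.bind (add_block T n i (slice_of T n c)) (add_block T n i) = Some s"
  shows "replaces 1 (slice_of T n c) s C (add2_rightmost T n i c C)"
  using assms by (auto simp: replaces_def add2_rightmost_def Let_def mset_update_rightmost Suc_le_eq)

lemma replaces_twice:
  assumes "\<And>C. replaces 1 s s' C (f C)" and "s \<noteq> s'"
  shows "replaces 2 s s' C (Option.bind (f C) f)"
proof (cases "1 \<le> count (mset C) s")
  case True
  then obtain D where D: "f C = Some D" "add_mset s (mset D) = add_mset s' (mset C)"
    using assms(1)[of C] by (auto simp: replaces_def)
  \<comment> \<open>Since \<open>s \<noteq> s'\<close>, the first replacement creates no new copy of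
    \<open>s\<close>, so the second one succeeds exactly if there were two copies at the
    start.\<close>
  from arg_cong[OF D(2), of "\<lambda>M. count M s"] have c: "Suc (count (mset D) s) = count (mset C) s"
    using assms(2) by simp
  show ?thesis
  proof (cases "1 \<le> count (mset D) s")
    case True
    then obtain E where E: "f D = Some E" "add_mset s (mset E) = add_mset s' (mset D)"
      using assms(1)[of D] by (auto simp: replaces_def)
    have "add_mset s (add_mset s (mset E)) = add_mset s' (add_mset s (mset D))"
      using E(2) by (simp add: add_mset_commute)
    moreover have "2 \<le> count (mset C) s" using c True by linarith
    ultimately show ?thesis
      using D E by (auto simp: replaces_def numeral_2_eq_2)
  next
    case False
    then have "\<not> 2 \<le> count (mset C) s" using c by linarith
    then show ?thesis
      using D False assms(1)[of D] by (auto simp: replaces_def)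
  qed
next
  case False
  then have c: "count (mset C) s = 0" by linarith
  then have "f C = None" using assms(1)[of C] unfolding replaces_def c by simp
  then show ?thesis unfolding replaces_def c by simp
qed

lemma counts_simps:
  assumes "admissible T n" and "b \<in> perfect_set T n l"
  shows "1 \<le> i \<Longrightarrow> i \<le> n \<Longrightarrow> counts T n (column_of T n l b) (S i) = b (S i)"
    and "1 \<le> i \<Longrightarrow> i \<le> n \<Longrightarrow> counts T n (column_of T n l b) (Sbar i) = b (Sbar i)"
    and "T = D2 \<or> T = B1 \<Longrightarrow> counts T n (column_of T n l b) S0 = b S0"
    and "bottom_00 T \<Longrightarrow> counts T n (column_of T n l b) Star = l_prime T n l b"
  using assms counts_column_of_entry[OF assms] by (auto simp: entry_def)

lemma replaces_arrow:
  assumes "admissible T n" and "i \<le> n" and "b \<in> perfect_set T n l"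
  obtains s where "remove_delta T n s = slice_of T n (snd (arrow T n i b))"
    and "replaces (amount T i b) (slice_of T n (fst (arrow T n i b))) s
      (column_of T n l b) (add_to_column T n i (column_of T n l b))"
proof -
  let ?C = "column_of T n l b" and ?a = "arrow T n i b"
  note result = that
  note defs = arrow_def amount_def add_to_column_def counts_simps Let_def
  have single: thesis if "block_move T n i (fst ?a) (snd ?a)" "amount T i b = 1"
    "add_to_column T n i ?C = add_rightmost T n i (fst ?a) ?C"
  proof -
    from that(1) obtain s where "add_block T n i (slice_of T n (fst ?a)) = Some s"
      "remove_delta T n s = slice_of T n (snd ?a)"
      by (auto simp: block_move_def)
    then show thesis
      using result replaces_add_rightmost that(2,3) by metis
  qed
  have double: thesis if "block_move T n i (fst ?a) (snd ?a)" "amount T i b = 2"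
    "add_to_column T n i ?C = Option.bind (add_rightmost T n i (fst ?a) ?C) (add_rightmost T n i (fst ?a))"
  proof -
    from that(1) obtain s where s: "add_block T n i (slice_of T n (fst ?a)) = Some s"
      "remove_delta T n s = slice_of T n (snd ?a)"
      by (auto simp: block_move_def)
    have "slice_of T n (fst ?a) \<noteq> slice_of T n (snd ?a)"
      using inj_on_slice_of[OF assms(1)] arrow_classes[OF assms(1,2)] by (meson inj_onD)
    \<comment> \<open>\<open>remove_delta\<close> fixes the source slice but sends \<open>s\<close>
      to the slice of a different class.\<close>
    then have "slice_of T n (fst ?a) \<noteq> s"
      using s(2) remove_delta_slice_of[OF assms(1) arrow_classes(1)[OF assms(1,2)]] by metis
    then have "replaces 2 (slice_of T n (fst ?a)) s ?C (add_to_column T n i ?C)"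
      unfolding that(3) by (intro replaces_twice replaces_add_rightmost s(1))
    then show thesis using result[OF s(2)] that(2) by simp
  qed
  from assms(1,2) show thesis
  proof (cases rule: index_cases)
    case generic
    then show ?thesis
      using block_move_ascending[OF assms(1)] block_move_descending[OF assms(1)] assms
      by (intro single) (simp_all add: defs)
  next
    case bottom_00
    show ?thesis
    proof (cases "T = C1")
      case True
      show ?thesis
      proof (cases "b (S 1) = b (Sbar 1) - 1")
        case mid: True
        then have a: "?a = (Sbar 1, S 1)" "amount T i b = 1"
          "add_to_column T n i ?C = add2_rightmost T n i (Sbar 1) ?C"
          using bottom_00 True assms by (simp_all add: defs)
        obtain s where "Option.bind (add_block T n 0 (slice_of T n (Sbar 1))) (add_block T n 0) = Some s"
          "remove_delta T n s = slice_of T n (S 1)"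
          using double_block_move[OF assms(1) \<open>bottom_00 T\<close>] by metis
        then show ?thesis
          using result a \<open>i = 0\<close> replaces_add2_rightmost by (metis fst_conv snd_conv)
      next
        case False
        then show ?thesis
          using True bottom_00 block_moves_bottom_00[OF assms(1)] assms
          by (intro double) (simp_all add: defs)
      qed
    next
      case False
      then show ?thesis
        using bottom_00 block_moves_bottom_00[OF assms(1)] assms
        by (intro single) (simp_all add: defs)
    qed
  next
    case bottom_01
    from bottom_01(2) show ?thesis
      using block_moves_bottom_01[OF assms(1)] bottom_01(1,3-) assms(1,3)
      by (elim disjE; intro single) (simp_all add: defs)
  next
    case last
    consider "T = D1" | "T = D2 \<or> T = B1" | "T \<notin> {D2, B1, D1}" by blast
    then show ?thesis
    proof cases
      case 1
      then show ?thesis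
        using block_moves_peak_D1[of n] last assms by (intro single) (simp_all add: defs)
    next
      case 2
      then show ?thesis
        using block_moves_peak_nn[OF assms(1)] last assms by (intro single) (auto simp: defs)
    next
      case 3
      then show ?thesis
        using block_move_peak_Whole[OF assms(1)] last assms by (intro single) (auto simp: defs)
    qed
  next
    case next_to_last
    then show ?thesis
      using block_moves_peak_D1[of n] assms
      by (intro single) (simp_all add: defs)
  qed
qed

text \<open>Both results are compared as multisets after adding \<open>k\<close> source slices to
  each; these cancel at the end, and \<open>rearrange_eqI\<close> turns equal multisets into equal
  columns.\<close>

lemma column_f_column_of:
  assumes "admissible T n" and "i \<le> n" and "b \<in> perfect_set T n l"
  shows "column_f T n l i (column_of T n l b) = map_option (column_of T n l) (perfect_f T n l i b)"
proof -
  define k c c' where "k = amount T i b" and "c = fst (arrow T n i b)" and "c' = snd (arrow T n i b)"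
  let ?C = "column_of T n l b" and ?b = "transfer k c c' b"
  note cc = arrow_classes[OF assms(1,2), of b, folded c_def c'_def]
  have move: "perfect_move T n i b = ?b"
    and iff: "?b \<in> perfect_set T n l \<longleftrightarrow> int k \<le> entry T n l b c"
    using perfect_move_arrow[OF assms] perfect_move_in_perfect_set_iff[OF assms]
    by (simp_all add: k_def c_def c'_def)
  obtain s where s: "remove_delta T n s = slice_of T n c'"
    and R: "replaces k (slice_of T n c) s ?C (add_to_column T n i ?C)"
    using replaces_arrow[OF assms] unfolding k_def c_def c'_def by blast
  have count: "int (count (mset ?C) (slice_of T n c)) = entry T n l b c"
    using counts_column_of_entry[OF assms(1,3) cc(1)] by (simp add: counts_def count_mset)
  show ?thesis
  proof (cases "int k \<le> entry T n l b c")
    case True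
    then have "k \<le> count (mset ?C) (slice_of T n c)" using count by linarith
    then obtain D where D: "add_to_column T n i ?C = Some D"
      and mset_D: "replicate_mset k (slice_of T n c) + mset D = replicate_mset k s + mset ?C"
      using R unfolding replaces_def by auto
    \<comment> \<open>The old column is reduced, so applying \<open>remove_delta\<close> to every
      slice affects only the slices that received blocks.\<close>
    have fixed: "image_mset (remove_delta T n) (mset ?C) = mset ?C"
    proof -
      have "remove_delta T n s = s" if "s \<in># mset ?C" for s
        using that set_class_mset[OF assms(1), of l b] remove_delta_slice_of[OF assms(1)]
        by (auto simp: mset_column_of simp del: set_mset_mset)
      then show ?thesis by (rule multiset.map_ident_strong)
    qed
    have "replicate_mset k (slice_of T n c) + image_mset (remove_delta T n) (mset D)
        = replicate_mset k (slice_of T n c') + mset ?C"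
      using arg_cong[OF mset_D, of "image_mset (remove_delta T n)"] s fixed
        remove_delta_slice_of[OF assms(1) cc(1)] by simp
    also have "\<dots> = replicate_mset k (slice_of T n c) + mset (column_of T n l ?b)"
      using arg_cong[OF class_mset_transfer[OF assms(1) cc(1,2) assms(3) True cc(3)],
          of "image_mset (slice_of T n)"] by (simp add: mset_column_of)
    finally have "mset (map (remove_delta T n) D) = mset (column_of T n l ?b)" by simp
    then have "rearrange T n l (map (remove_delta T n) D) = column_of T n l ?b"
      using rearrange_eqI[OF assms(1)] iff True by simp
    then show ?thesis
      using D iff True by (simp add: column_f_def perfect_f_def move)
  next
    case False
    then have "\<not> k \<le> count (mset ?C) (slice_of T n c)" using count by linarith
    then have "add_to_column T n i ?C = None"
      using R unfolding replaces_def by simp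
    then show ?thesis
      using iff False by (simp add: column_f_def perfect_f_def move)
  qed
qed

text \<open>\<open>counts\<close> is known to agree with the vector only on labels that are classes,
  so each case checks that the formulas read only such labels, and \<open>Star\<close> only over
  (0,0).\<close>

lemma formulas_column_of:
  assumes "admissible T n" and "i \<le> n" and "b \<in> perfect_set T n l"
  defines "x \<equiv> counts T n (column_of T n l b)"
  shows "eps_formula T n (x Star) x i = eps_formula T n (l_prime T n l b) b i"
    and "phi_formula T n (x Star) x i = phi_formula T n (l_prime T n l b) b i"
proof -
  note defs = eps_formula_def phi_formula_def x_def counts_simps
  have "eps_formula T n (x Star) x i = eps_formula T n (l_prime T n l b) b i
    \<and> phi_formula T n (x Star) x i = phi_formula T n (l_prime T n l b) b i"
    using assms(1,2)
  proof (cases rule: index_cases)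
    case bottom_01
    from bottom_01(2) show ?thesis
      using bottom_01(1,3-) assms(1,3) by (elim disjE) (simp_all add: defs)
  qed (use assms(1,3) in \<open>auto simp: defs\<close>)
  then show "eps_formula T n (x Star) x i = eps_formula T n (l_prime T n l b) b i"
    and "phi_formula T n (x Star) x i = phi_formula T n (l_prime T n l b) b i" by simp_all
qed

section \<open>Transport of operators\<close>

lemma inverse_operator_iff:
  assumes "\<And>a b. a \<in> X \<Longrightarrow> b \<in> X \<Longrightarrow> f a = Some d \<Longrightarrow> f b = Some d \<Longrightarrow> a = b" and "b \<in> X"
  shows "inverse_operator X f d = Some b \<longleftrightarrow> f b = Some d"
proof -
  have "(THE b'. b' \<in> X \<and> f b' = Some d) = a" if "a \<in> X" "f a = Some d" for a
    using that assms(1) by (intro the_equality) blast+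
  then show ?thesis
    using assms(2) by (auto simp: inverse_operator_def)
qed

lemma inverse_operator_range:
  assumes "\<And>a b. a \<in> X \<Longrightarrow> b \<in> X \<Longrightarrow> f a = Some d \<Longrightarrow> f b = Some d \<Longrightarrow> a = b"
  shows "inverse_operator X f d \<in> insert None (Some ` X)"
proof (cases "\<exists>b\<in>X. f b = Some d")
  case True
  then obtain b where "b \<in> X" "f b = Some d" by blast
  then show ?thesis using inverse_operator_iff[of X f d b] assms by auto
qed (simp add: inverse_operator_def)

text \<open>Preimages of \<open>d\<close> under \<open>f\<close> and of \<open>g d\<close> under
  \<open>f'\<close> correspond through \<open>g\<close>; the range condition on \<open>f\<close>
  keeps its values in \<open>X\<close>, where \<open>g\<close> is injective.\<close>

lemma inverse_operator_image:
  assumes "inj_on g X" and "\<And>b. b \<in> X \<Longrightarrow> f b \<in> insert None (Some ` X)"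
    and "\<And>b. b \<in> X \<Longrightarrow> f' (g b) = map_option g (f b)"
    and "\<And>a b. a \<in> X \<Longrightarrow> b \<in> X \<Longrightarrow> f a = Some d \<Longrightarrow> f b = Some d \<Longrightarrow> a = b" and "d \<in> X"
  shows "inverse_operator (g ` X) f' (g d) = map_option g (inverse_operator X f d)"
proof -
  have iff: "f' (g b) = Some (g d) \<longleftrightarrow> f b = Some d" if "b \<in> X" for b
  proof (cases "f b")
    case (Some a)
    then have "a \<in> X" using assms(2)[OF that] by auto
    then show ?thesis
      using Some assms(1,5) by (simp add: assms(3)[OF that] inj_on_eq_iff)
  qed (simp add: assms(3)[OF that])
  show ?thesis
  proof (cases "\<exists>b\<in>X. f b = Some d")
    case True
    then obtain b where b: "b \<in> X" "f b = Some d" by blast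
    have "inverse_operator (g ` X) f' (g d) = Some (g b)"
      using b iff assms(4) by (subst inverse_operator_iff) auto
    moreover have "inverse_operator X f d = Some b"
      using b assms(4) by (subst inverse_operator_iff) auto
    ultimately show ?thesis by simp
  next
    case False
    then show ?thesis using iff by (auto simp: inverse_operator_def)
  qed
qed

section \<open>The two crystals and their isomorphism\<close>

lemma perfect_f_range: "perfect_f T n l i b \<in> insert None (Some ` perfect_set T n l)"
  by (simp add: perfect_f_def Let_def)

lemma crystal_simps [simp]:
  "elements (perfect_crystal T n l) = perfect_set T n l"
  "op_e (perfect_crystal T n l) i = inverse_operator (perfect_set T n l) (perfect_f T n l i)"
  "op_f (perfect_crystal T n l) = perfect_f T n l"
  "elements (column_crystal T n l) = column_of T n l ` perfect_set T n l"
  "op_e (column_crystal T n l) i = inverse_operator (column_of T n l ` perfect_set T n l) (column_f T n l i)"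
  "op_f (column_crystal T n l) = column_f T n l"
  by (simp_all add: perfect_crystal_def column_crystal_def column_set_def Let_def)

lemma kashiwara_operatorsI:
  assumes "\<And>i. op_e A i = inverse_operator (elements A) (op_f A i)"
    and "\<And>i b. i \<in> I \<Longrightarrow> b \<in> elements A \<Longrightarrow> op_f A i b \<in> insert None (Some ` elements A)"
    and "\<And>i a b d. i \<in> I \<Longrightarrow> a \<in> elements A \<Longrightarrow> b \<in> elements A \<Longrightarrow>
      op_f A i a = Some d \<Longrightarrow> op_f A i b = Some d \<Longrightarrow> a = b"
  shows "kashiwara_operators I A"
  unfolding kashiwara_operators_def
proof (intro ballI conjI)
  fix i d assume i: "i \<in> I" and d: "d \<in> elements A"
  show "op_e A i d \<in> insert None (Some ` elements A)"
    unfolding assms(1) by (rule inverse_operator_range) (rule assms(3)[OF i])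
  show "op_f A i d \<in> insert None (Some ` elements A)"
    using i d by (rule assms(2))
  show "op_e A i d = Some b \<longleftrightarrow> op_f A i b = Some d" if "b \<in> elements A" for b
    unfolding assms(1) by (rule inverse_operator_iff[OF _ that]) (rule assms(3)[OF i])
qed

lemma kashiwara_operators_perfect:
  assumes "admissible T n"
  shows "kashiwara_operators {0..n} (perfect_crystal T n l)"
proof (rule kashiwara_operatorsI)
  fix i a b d
  assume "i \<in> {0..n}" "a \<in> elements (perfect_crystal T n l)" "b \<in> elements (perfect_crystal T n l)"
    "op_f (perfect_crystal T n l) i a = Some d" "op_f (perfect_crystal T n l) i b = Some d"
  then show "a = b" using perfect_f_inj[OF assms, of i a l b d] by simp
qed (simp_all only: crystal_simps perfect_f_range)

text \<open>Pulled back to vectors: equal columns have equal vectors, so injectivity of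
  \<open>perfect_f\<close> applies.\<close>

lemma column_f_inj:
  assumes "admissible T n" and "i \<le> n"
    and "C \<in> column_of T n l ` perfect_set T n l" "C' \<in> column_of T n l ` perfect_set T n l"
    and "column_f T n l i C = Some D" "column_f T n l i C' = Some D"
  shows "C = C'"
proof -
  obtain a b where ab: "a \<in> perfect_set T n l" "C = column_of T n l a"
    "b \<in> perfect_set T n l" "C' = column_of T n l b"
    using assms(3,4) by blast
  obtain a' b' where f: "perfect_f T n l i a = Some a'" "column_of T n l a' = D"
    "perfect_f T n l i b = Some b'" "column_of T n l b' = D"
    using assms(5,6) ab column_f_column_of[OF assms(1,2)] by auto
  then have "a' \<in> perfect_set T n l" "b' \<in> perfect_set T n l"
    using perfect_f_range[of T n l i a] perfect_f_range[of T n l i b] by auto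
  then have "a' = b'"
    using f inj_on_column_of[OF assms(1)] by (metis inj_onD)
  then show ?thesis
    using perfect_f_inj[OF assms(1,2)] ab f by metis
qed

lemma kashiwara_operators_column:
  assumes "admissible T n"
  shows "kashiwara_operators {0..n} (column_crystal T n l)"
proof (rule kashiwara_operatorsI)
  fix i C assume "i \<in> {0..n}" and "C \<in> elements (column_crystal T n l)"
  then obtain b where "b \<in> perfect_set T n l" and C: "C = column_of T n l b" and "i \<le> n" by auto
  then have "column_f T n l i C = map_option (column_of T n l) (perfect_f T n l i b)"
    using column_f_column_of[OF assms] by simp
  then show "op_f (column_crystal T n l) i C \<in> insert None (Some ` elements (column_crystal T n l))"
    using perfect_f_range[of T n l i b] by auto
next
  fix i C C' D
  assume "i \<in> {0..n}" "C \<in> elements (column_crystal T n l)" "C' \<in> elements (column_crystal T n l)"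
    "op_f (column_crystal T n l) i C = Some D" "op_f (column_crystal T n l) i C' = Some D"
  then show "C = C'" using column_f_inj[OF assms, of i C l C' D] by simp
qed (simp only: crystal_simps)

theorem theorem3p10:
  fixes T :: affine_type and n l :: nat
  assumes "admissible T n" and "l \<ge> 1"
  shows "\<exists>\<Phi>. (\<forall>b\<in>perfect_set T n l. \<Phi> (column_of T n l b) = b) \<and>
           crystal_iso {0..n} (column_crystal T n l) (perfect_crystal T n l) \<Phi>"
proof (intro exI conjI ballI)
  let ?X = "perfect_set T n l" and ?col = "column_of T n l" and ?\<Phi> = "vector_of T n"
  note adm = assms(1)
  show inv: "?\<Phi> (?col b) = b" if "b \<in> ?X" for b
    using that by (rule vector_of_column_of[OF adm])
  have map: "map_option ?\<Phi> (map_option ?col r) = r" if "r \<in> insert None (Some ` ?X)" for r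
    using that inv by auto
  show "crystal_iso {0..n} (column_crystal T n l) (perfect_crystal T n l) ?\<Phi>"
    unfolding crystal_iso_def
  proof (intro conjI ballI kashiwara_operators_perfect kashiwara_operators_column adm)
    show "bij_betw ?\<Phi> (elements (column_crystal T n l)) (elements (perfect_crystal T n l))"
      using inv by (auto simp: bij_betw_def inj_on_def image_image)
  next
    fix C assume "C \<in> elements (column_crystal T n l)"
    then obtain b where b: "b \<in> ?X" and C: "C = ?col b" by auto
    have eps: "eps (perfect_crystal T n l) i (?\<Phi> C) = eps (column_crystal T n l) i C"
      and phi: "phi (perfect_crystal T n l) i (?\<Phi> C) = phi (column_crystal T n l) i C" if "i \<le> n" for i
      using formulas_column_of[OF adm that b] inv[OF b]
      by (simp_all add: C perfect_crystal_def column_crystal_def Let_def)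
    show "wt (perfect_crystal T n l) (?\<Phi> C) = wt (column_crystal T n l) C"
    proof -
      have "wt (perfect_crystal T n l) (?\<Phi> C) = weight n (\<lambda>i. phi (perfect_crystal T n l) i (?\<Phi> C))
          (\<lambda>i. eps (perfect_crystal T n l) i (?\<Phi> C))"
        by (simp add: perfect_crystal_def Let_def)
      also have "\<dots> = weight n (\<lambda>i. phi (column_crystal T n l) i C) (\<lambda>i. eps (column_crystal T n l) i C)"
        \<comment> \<open>The agreement of \<open>eps\<close> and \<open>phi\<close> is known only
          for \<open>i \<le> n\<close>, which is the range of the sum in
          \<open>weight\<close>.\<close>
        unfolding weight_def by (rule sum.cong) (simp_all add: eps phi)
      also have "\<dots> = wt (column_crystal T n l) C"
        by (simp add: column_crystal_def Let_def)
      finally show ?thesis .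
    qed
    fix i assume "i \<in> {0..n}"
    then have i: "i \<le> n" by simp
    show "eps (perfect_crystal T n l) i (?\<Phi> C) = eps (column_crystal T n l) i C"
      "phi (perfect_crystal T n l) i (?\<Phi> C) = phi (column_crystal T n l) i C"
      using eps phi i by auto
    show "op_f (perfect_crystal T n l) i (?\<Phi> C) = map_option ?\<Phi> (op_f (column_crystal T n l) i C)"
      using map[OF perfect_f_range] inv[OF b] by (simp add: C column_f_column_of[OF adm i b])
    \<comment> \<open>The transport goes from vectors to columns, where injectivity is at hand;
      \<open>map\<close> then cancels \<open>?col\<close> against \<open>?\<Phi>\<close> to give the
      required direction.\<close>
    have "inverse_operator (?col ` ?X) (column_f T n l i) (?col b)
        = map_option ?col (inverse_operator ?X (perfect_f T n l i) b)"
    proof (rule inverse_operator_image)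
      show "column_f T n l i (?col a) = map_option ?col (perfect_f T n l i a)" if "a \<in> ?X" for a
        using adm i that by (rule column_f_column_of)
      show "a = a'" if "a \<in> ?X" "a' \<in> ?X" "perfect_f T n l i a = Some b" "perfect_f T n l i a' = Some b"
        for a a' using adm i that by (rule perfect_f_inj)
    qed (use inj_on_column_of[OF adm] b in \<open>simp_all only: perfect_f_range\<close>)
    moreover have "inverse_operator ?X (perfect_f T n l i) b \<in> insert None (Some ` ?X)"
      by (rule inverse_operator_range) (rule perfect_f_inj[OF adm i])
    ultimately show "op_e (perfect_crystal T n l) i (?\<Phi> C) = map_option ?\<Phi> (op_e (column_crystal T n l) i C)"
      by (simp only: C crystal_simps inv[OF b] map)
  qed
qed

end
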